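(* Let $k\geq 1$ and let $M$ be a smooth manifold. There is a one-to-one correspondence between (i) subbundles $L\subset TM\oplus\wedge^kT^*M$ that are isotropic, involutive, and satisfy $L^\perp\cap TM=\{0\}$; and (ii) pairs $(D,\lambda)$, where $D\subseteq\wedge^kT^*M$ is a subbundle and $\lambda:D\to TM$ is a vector-bundle map covering the identity of $M$, satisfying the following conditions: \begin{itemize} \item[(a)] $D^\circ=\{0\}$; \item[(b)] $i_{\lambda(\alpha)}\beta=-i_{\lambda(\beta)}\alpha$ for all $\alpha,\beta\in D$ (in the same fibre); \item[(c)] the space $\Gamma(D)$ is closed under the bracket $$[\alpha,\beta]_\lambda:=\mathcal{L}_{\lambda(\alpha)}\beta-i_{\lambda(\beta)}d\alpha=\mathcal{L}_{\lambda(\alpha)}\beta-\mathcal{L}_{\lambda(\beta)}\alpha-d(i_{\lambda(\alpha)}\beta),$$ and $\lambda:\Gamma(D)\to\Gamma(TM)$ preserves brackets, i.e. $\lambda([\alpha,\beta]_\lambda)=[\lambda(\alpha),\lambda(\beta)]$ for all $\alpha,\beta\in\Gamma(D)$. \end{itemize} The correspondence assigns to $L$ the pair $D=\mathrm{pr}_2(L)$, $\lambda=\mathrm{pr}_1\circ(\mathrm{pr}_2|_L)^{-1}$, and to $(D,\lambda)$ the subbundle $L=\{(\lambda(\alpha),\alpha)\mid\alpha\in D\}$.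
   Context: Everything is smooth. Let $\mathbb{T}M^{(k)}=TM\oplus\wedge^kT^*M$ with projections $\mathrm{pr}_1:\mathbb{T}M^{(k)}\to TM$ and $\mathrm{pr}_2:\mathbb{T}M^{(k)}\to\wedge^kT^*M$. It carries the fibrewise symmetric $\wedge^{k-1}T^*M$-valued pairing $$\langle (X,\alpha),(Y,\beta)\rangle=i_X\beta+i_Y\alpha$$ and, on sections, the (higher) Courant–Dorfman bracket $$[\![(X,\alpha),(Y,\beta)]\!]=([X,Y],\ \mathcal{L}_X\beta-i_Yd\alpha).$$ For a subbundle $L\subset\mathbb{T}M^{(k)}$, $L^\perp$ denotes its fibrewise orthogonal with respect to $\langle\cdot,\cdot\rangle$ (possibly of non-constant rank); $L$ is isotropic if $L\subset L^\perp$, and involutive if $\Gamma(L)$ is closed under $[\![\cdot,\cdot]\!]$. $TM$ is regarded as the subbundle $TM\oplus 0$ of $\mathbb{T}M^{(k)}$. For a subbundle $D\subseteq\wedge^kT^*M$, its annihilator is $D^\circ=\{X\in TM\mid i_X\alpha=0\ \forall\alpha\in D\}$ (fibrewise: for $X\in T_xM$, $\alpha$ ranges over $D|_x$). *)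

theory Defs
  imports "HOL-Analysis.Analysis" "HOL-Library.Function_Algebras"
begin

section \<open>Pointwise real vector space structure on functions\<close>

instantiation "fun" :: (type, scaleR) scaleR
begin
definition scaleR_fun_def: "r *\<^sub>R f = (\<lambda>x. r *\<^sub>R f x)"
instance ..
end

instance "fun" :: (type, real_vector) real_vector
  by standard (simp_all add: scaleR_fun_def plus_fun_def scaleR_add_right scaleR_add_left)


section \<open>Smooth manifolds\<close>

text \<open>Smoothness on an open set: all iterated directional derivatives exist and are continuous.
  It is used for functions defined on open subsets of a finite-dimensional normed space, where
  this is the usual notion of a smooth function.\<close>

primrec Ck_on :: "nat \<Rightarrow> 'a::real_normed_vector set \<Rightarrow> ('a \<Rightarrow> 'b::real_normed_vector) \<Rightarrow> bool" where
  "Ck_on 0 S f \<longleftrightarrow> continuous_on S f"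
| "Ck_on (Suc n) S f \<longleftrightarrow>
     (\<forall>p\<in>S. f differentiable (at p)) \<and> (\<forall>v. Ck_on n S (\<lambda>p. frechet_derivative f (at p) v))"

definition smooth_on :: "'a::real_normed_vector set \<Rightarrow> ('a \<Rightarrow> 'b::real_normed_vector) \<Rightarrow> bool" where
  "smooth_on S f \<longleftrightarrow> (\<forall>n. Ck_on n S f)"

text \<open>A chart is a pair of its domain and its coordinate map; the values of the coordinate map
  outside the domain are irrelevant. The manifold \<open>M\<close> is the whole type \<open>'m\<close>. The model space
  \<open>'e\<close> is a finite-dimensional normed space rather than of class \<open>euclidean_space\<close>, since that
  class excludes dimension 0.\<close>

type_synonym ('m, 'e) chart = "'m set \<times> ('m \<Rightarrow> 'e)"

abbreviation (input) cdom :: "('m, 'e) chart \<Rightarrow> 'm set" where "cdom \<equiv> fst"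
abbreviation (input) crd :: "('m, 'e) chart \<Rightarrow> 'm \<Rightarrow> 'e" where "crd \<equiv> snd"
abbreviation (input) crd_inv :: "('m, 'e) chart \<Rightarrow> 'e \<Rightarrow> 'm" where "crd_inv c \<equiv> inv_into (cdom c) (crd c)"

definition is_chart :: "('m::topological_space, 'e::real_normed_vector) chart \<Rightarrow> bool" where
  "is_chart c \<longleftrightarrow> open (cdom c) \<and> open (crd c ` cdom c) \<and>
     homeomorphism (cdom c) (crd c ` cdom c) (crd c) (crd_inv c)"

definition smooth_manifold ::
  "('m::{t2_space, second_countable_topology}, 'e::real_normed_vector) chart set \<Rightarrow> bool" where
  "smooth_manifold A \<longleftrightarrow>
     (\<exists>B::'e set. finite B \<and> span B = UNIV) \<and>
     (\<forall>c\<in>A. is_chart c) \<and>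
     (\<Union>c\<in>A. cdom c) = UNIV \<and>
     (\<forall>c\<in>A. \<forall>c'\<in>A. smooth_on (crd c ` (cdom c \<inter> cdom c')) (crd c' \<circ> crd_inv c))"


section \<open>Tangent vectors and exterior forms\<close>

text \<open>A tangent vector at \<open>x\<close> is the family of its coordinate representations in the charts
  around \<open>x\<close>, any two of which are related by the derivative of the change of coordinates (and
  0 is the value at all other charts). \<open>coord_vec A c x v\<close> is the tangent vector at \<open>x\<close>
  represented by \<open>v\<close> in the chart \<open>c\<close>.\<close>

type_synonym ('m, 'e) tvec = "('m, 'e) chart \<Rightarrow> 'e"

definition coord_vec ::
  "('m, 'e::real_normed_vector) chart set \<Rightarrow> ('m, 'e) chart \<Rightarrow> 'm \<Rightarrow> 'e \<Rightarrow> ('m, 'e) tvec" where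
  "coord_vec A c x v = (\<lambda>c'. if c' \<in> A \<and> x \<in> cdom c'
     then frechet_derivative (crd c' \<circ> crd_inv c) (at (crd c x)) v else 0)"

definition tangent_space ::
  "('m, 'e::real_normed_vector) chart set \<Rightarrow> 'm \<Rightarrow> ('m, 'e) tvec set" where
  "tangent_space A x = {V. (\<forall>c. \<not> (c \<in> A \<and> x \<in> cdom c) \<longrightarrow> V c = 0) \<and>
     (\<forall>c\<in>A. x \<in> cdom c \<longrightarrow> V = coord_vec A c x (V c))}"

text \<open>A \<open>k\<close>-form takes the list of its \<open>k\<close> arguments. To make equality of forms on a subspace
  \<open>S\<close> the equality of functions, it vanishes on all lists that are not \<open>k\<close>-tuples from \<open>S\<close>.\<close>

type_synonym 'v form = "'v list \<Rightarrow> real"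

definition alt_forms :: "nat \<Rightarrow> 'v::real_vector set \<Rightarrow> 'v form set" where
  "alt_forms k S = {\<alpha>.
     (\<forall>vs. \<not> (length vs = k \<and> set vs \<subseteq> S) \<longrightarrow> \<alpha> vs = 0) \<and>
     (\<forall>vs. length vs = k \<and> set vs \<subseteq> S \<longrightarrow>
        (\<forall>i<k. \<forall>u\<in>S. \<forall>w\<in>S. \<forall>r.
           \<alpha> (vs[i := r *\<^sub>R u + w]) = r * \<alpha> (vs[i := u]) + \<alpha> (vs[i := w])) \<and>
        (\<forall>i<k. \<forall>j<k. i \<noteq> j \<and> vs ! i = vs ! j \<longrightarrow> \<alpha> vs = 0))}"

definition interior_prod :: "'v \<Rightarrow> 'v form \<Rightarrow> 'v form" where
  "interior_prod X \<alpha> = (\<lambda>vs. \<alpha> (X # vs))"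

abbreviation cotangent_power ::
  "('m, 'e::real_normed_vector) chart set \<Rightarrow> nat \<Rightarrow> 'm \<Rightarrow> ('m, 'e) tvec form set" where
  "cotangent_power A k x \<equiv> alt_forms k (tangent_space A x)"


section \<open>Vector fields and differential forms\<close>

definition local_vec ::
  "('m, 'e) chart \<Rightarrow> ('m \<Rightarrow> ('m, 'e) tvec) \<Rightarrow> 'e \<Rightarrow> 'e" where
  "local_vec c X p = X (crd_inv c p) c"

definition local_form ::
  "('m, 'e::real_normed_vector) chart set \<Rightarrow> ('m, 'e) chart \<Rightarrow> ('m \<Rightarrow> ('m, 'e) tvec form) \<Rightarrow> 'e \<Rightarrow> 'e form" where
  "local_form A c \<alpha> p vs = \<alpha> (crd_inv c p) (map (coord_vec A c (crd_inv c p)) vs)"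

definition vector_fields ::
  "('m, 'e::real_normed_vector) chart set \<Rightarrow> 'm set \<Rightarrow> ('m \<Rightarrow> ('m, 'e) tvec) set" where
  "vector_fields A W = {X. (\<forall>x\<in>W. X x \<in> tangent_space A x) \<and>
     (\<forall>c\<in>A. smooth_on (crd c ` (cdom c \<inter> W)) (local_vec c X))}"

definition diff_forms ::
  "('m, 'e::real_normed_vector) chart set \<Rightarrow> nat \<Rightarrow> 'm set \<Rightarrow> ('m \<Rightarrow> ('m, 'e) tvec form) set" where
  "diff_forms A k W = {\<alpha>. (\<forall>x\<in>W. \<alpha> x \<in> cotangent_power A k x) \<and>
     (\<forall>c\<in>A. \<forall>vs. smooth_on (crd c ` (cdom c \<inter> W)) (\<lambda>p. local_form A c \<alpha> p vs))}"

definition lie_bracket ::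
  "('m, 'e::real_normed_vector) chart set \<Rightarrow> ('m \<Rightarrow> ('m, 'e) tvec) \<Rightarrow> ('m \<Rightarrow> ('m, 'e) tvec) \<Rightarrow> 'm \<Rightarrow> ('m, 'e) tvec" where
  "lie_bracket A X Y = (\<lambda>x c. if c \<in> A \<and> x \<in> cdom c
     then frechet_derivative (local_vec c Y) (at (crd c x)) (X x c)
        - frechet_derivative (local_vec c X) (at (crd c x)) (Y x c)
     else 0)"

text \<open>The exterior derivative and the Lie derivative of a form are given at \<open>x\<close> by the classical
  coordinate expressions, which do not depend on the chart around \<open>x\<close>. For constant vectors
  \<open>v\<^sub>0, \<dots>, v\<^sub>k\<close> in the chart,
  \<open>d\<alpha>(v\<^sub>0,\<dots>,v\<^sub>k) = \<Sum>\<^sub>i (-1)\<^sup>i D\<alpha>[v\<^sub>i](v\<^sub>0,\<dots>,v\<^sub>i omitted,\<dots>,v\<^sub>k)\<close> and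
  \<open>(L\<^sub>X \<alpha>)(v\<^sub>1,\<dots>,v\<^sub>k) = D\<alpha>[X](v\<^sub>1,\<dots>,v\<^sub>k) + \<Sum>\<^sub>i \<alpha>(v\<^sub>1,\<dots>,DX[v\<^sub>i],\<dots>,v\<^sub>k)\<close>, where \<open>Df[v]\<close> is the
  derivative of \<open>f\<close> in direction \<open>v\<close>.\<close>

definition chart_at :: "('m, 'e) chart set \<Rightarrow> 'm \<Rightarrow> ('m, 'e) chart" where
  "chart_at A x = (SOME c. c \<in> A \<and> x \<in> cdom c)"

definition ext_deriv ::
  "('m, 'e::real_normed_vector) chart set \<Rightarrow> ('m \<Rightarrow> ('m, 'e) tvec form) \<Rightarrow> 'm \<Rightarrow> ('m, 'e) tvec form" where
  "ext_deriv A \<alpha> = (\<lambda>x Vs. if set Vs \<subseteq> tangent_space A x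
     then let c = chart_at A x; vs = map (\<lambda>V. V c) Vs in
       \<Sum>i<length vs. (-1) ^ i *
         frechet_derivative (\<lambda>p. local_form A c \<alpha> p (take i vs @ drop (Suc i) vs)) (at (crd c x)) (vs ! i)
     else 0)"

definition lie_deriv ::
  "('m, 'e::real_normed_vector) chart set \<Rightarrow> ('m \<Rightarrow> ('m, 'e) tvec) \<Rightarrow> ('m \<Rightarrow> ('m, 'e) tvec form) \<Rightarrow> 'm \<Rightarrow> ('m, 'e) tvec form" where
  "lie_deriv A X \<alpha> = (\<lambda>x Vs. if set Vs \<subseteq> tangent_space A x
     then let c = chart_at A x; vs = map (\<lambda>V. V c) Vs in
       frechet_derivative (\<lambda>p. local_form A c \<alpha> p vs) (at (crd c x)) (X x c)
       + (\<Sum>i<length vs. local_form A c \<alpha> (crd c x)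
            (vs[i := frechet_derivative (local_vec c X) (at (crd c x)) (vs ! i)]))
     else 0)"


section \<open>Subbundles\<close>

text \<open>An ambient bundle is given by its smooth local sections: \<open>sec W\<close> are those over the open
  set \<open>W\<close>. A subbundle is the family of its fibres, which locally have a smooth frame.\<close>

definition subbundle ::
  "('m::topological_space set \<Rightarrow> ('m \<Rightarrow> 'v::real_vector) set) \<Rightarrow> ('m \<Rightarrow> 'v set) \<Rightarrow> bool" where
  "subbundle sec L \<longleftrightarrow> (\<forall>x. \<exists>W r E. open W \<and> x \<in> W \<and> (\<forall>i<r. E i \<in> sec W) \<and>
     (\<forall>y\<in>W. inj_on (\<lambda>i::nat. E i y) {..<r} \<and> independent ((\<lambda>i. E i y) ` {..<r}) \<and>
            span ((\<lambda>i. E i y) ` {..<r}) = L y))"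

definition sections_of ::
  "('m set \<Rightarrow> ('m \<Rightarrow> 'v) set) \<Rightarrow> ('m \<Rightarrow> 'v set) \<Rightarrow> 'm set \<Rightarrow> ('m \<Rightarrow> 'v) set" where
  "sections_of sec L W = {s \<in> sec W. \<forall>x\<in>W. s x \<in> L x}"


section \<open>The bundle \<open>TM \<oplus> \<and>\<^sup>k T\<^sup>*M\<close>\<close>

type_synonym ('m, 'e) gvec = "('m, 'e) tvec \<times> ('m, 'e) tvec form"

definition gen_fields ::
  "('m, 'e::real_normed_vector) chart set \<Rightarrow> nat \<Rightarrow> 'm set \<Rightarrow> ('m \<Rightarrow> ('m, 'e) gvec) set" where
  "gen_fields A k W = {s. (\<lambda>x. fst (s x)) \<in> vector_fields A W \<and> (\<lambda>x. snd (s x)) \<in> diff_forms A k W}"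

definition pairing :: "'v \<times> 'v form \<Rightarrow> 'v \<times> 'v form \<Rightarrow> 'v form" where
  "pairing u v = interior_prod (fst u) (snd v) + interior_prod (fst v) (snd u)"

definition courant_bracket ::
  "('m, 'e::real_normed_vector) chart set \<Rightarrow> ('m \<Rightarrow> ('m, 'e) gvec) \<Rightarrow> ('m \<Rightarrow> ('m, 'e) gvec) \<Rightarrow> 'm \<Rightarrow> ('m, 'e) gvec" where
  "courant_bracket A s t = (let X = \<lambda>x. fst (s x); \<alpha> = \<lambda>x. snd (s x);
                                Y = \<lambda>x. fst (t x); \<beta> = \<lambda>x. snd (t x)
     in (\<lambda>x. (lie_bracket A X Y x, lie_deriv A X \<beta> x - interior_prod (Y x) (ext_deriv A \<alpha> x))))"

definition orthogonal_fibre ::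
  "('m, 'e::real_normed_vector) chart set \<Rightarrow> nat \<Rightarrow> ('m \<Rightarrow> ('m, 'e) gvec set) \<Rightarrow> 'm \<Rightarrow> ('m, 'e) gvec set" where
  "orthogonal_fibre A k L x =
     {u \<in> tangent_space A x \<times> cotangent_power A k x. \<forall>v\<in>L x. pairing u v = 0}"

definition isotropic ::
  "('m, 'e::real_normed_vector) chart set \<Rightarrow> nat \<Rightarrow> ('m \<Rightarrow> ('m, 'e) gvec set) \<Rightarrow> bool" where
  "isotropic A k L \<longleftrightarrow> (\<forall>x. L x \<subseteq> orthogonal_fibre A k L x)"

definition involutive ::
  "('m, 'e::real_normed_vector) chart set \<Rightarrow> nat \<Rightarrow> ('m \<Rightarrow> ('m, 'e) gvec set) \<Rightarrow> bool" where
  "involutive A k L \<longleftrightarrow> (\<forall>s\<in>sections_of (gen_fields A k) L UNIV. \<forall>t\<in>sections_of (gen_fields A k) L UNIV.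
     courant_bracket A s t \<in> sections_of (gen_fields A k) L UNIV)"

definition isotropic_involutive_subbundles ::
  "('m::topological_space, 'e::real_normed_vector) chart set \<Rightarrow> nat \<Rightarrow> ('m \<Rightarrow> ('m, 'e) gvec set) set" where
  "isotropic_involutive_subbundles A k = {L. subbundle (gen_fields A k) L \<and>
     isotropic A k L \<and> involutive A k L \<and>
     (\<forall>x. orthogonal_fibre A k L x \<inter> (tangent_space A x \<times> {0}) = {0})}"


section \<open>Pairs \<open>(D, \<lambda>)\<close>\<close>

definition annihilator ::
  "('m, 'e::real_normed_vector) chart set \<Rightarrow> ('m \<Rightarrow> ('m, 'e) tvec form set) \<Rightarrow> 'm \<Rightarrow> ('m, 'e) tvec set" where
  "annihilator A D x = {X \<in> tangent_space A x. \<forall>\<alpha>\<in>D x. interior_prod X \<alpha> = 0}"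

text \<open>Vector bundle maps \<open>D \<rightarrow> TM\<close> over the identity: fibrewise linear maps taking smooth local
  sections to smooth local sections. Each fibre map is \<open>undefined\<close> outside the fibre of \<open>D\<close>, so
  that equality of bundle maps is equality of functions.\<close>

definition bundle_maps_to_tangent ::
  "('m::topological_space, 'e::real_normed_vector) chart set \<Rightarrow> nat \<Rightarrow> ('m \<Rightarrow> ('m, 'e) tvec form set)
    \<Rightarrow> ('m \<Rightarrow> ('m, 'e) tvec form \<Rightarrow> ('m, 'e) tvec) set" where
  "bundle_maps_to_tangent A k D = {l.
     (\<forall>x. l x \<in> D x \<rightarrow>\<^sub>E tangent_space A x) \<and>
     (\<forall>x. \<forall>\<alpha>\<in>D x. \<forall>\<beta>\<in>D x. \<forall>r. l x (r *\<^sub>R \<alpha> + \<beta>) = r *\<^sub>R l x \<alpha> + l x \<beta>) \<and>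
     (\<forall>W. open W \<longrightarrow> (\<forall>\<alpha>\<in>sections_of (diff_forms A k) D W. (\<lambda>x. l x (\<alpha> x)) \<in> vector_fields A W))}"

definition skew ::
  "('m \<Rightarrow> ('m, 'e) tvec form set) \<Rightarrow> ('m \<Rightarrow> ('m, 'e) tvec form \<Rightarrow> ('m, 'e) tvec) \<Rightarrow> bool" where
  "skew D l \<longleftrightarrow> (\<forall>x. \<forall>\<alpha>\<in>D x. \<forall>\<beta>\<in>D x. interior_prod (l x \<alpha>) \<beta> = - interior_prod (l x \<beta>) \<alpha>)"

definition form_bracket ::
  "('m, 'e::real_normed_vector) chart set \<Rightarrow> ('m \<Rightarrow> ('m, 'e) tvec form \<Rightarrow> ('m, 'e) tvec)
    \<Rightarrow> ('m \<Rightarrow> ('m, 'e) tvec form) \<Rightarrow> ('m \<Rightarrow> ('m, 'e) tvec form) \<Rightarrow> 'm \<Rightarrow> ('m, 'e) tvec form" where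
  "form_bracket A l \<alpha> \<beta> = (\<lambda>x. lie_deriv A (\<lambda>y. l y (\<alpha> y)) \<beta> x
     - interior_prod (l x (\<beta> x)) (ext_deriv A \<alpha> x))"

definition bracket_pairs ::
  "('m::topological_space, 'e::real_normed_vector) chart set \<Rightarrow> nat \<Rightarrow>
    (('m \<Rightarrow> ('m, 'e) tvec form set) \<times> ('m \<Rightarrow> ('m, 'e) tvec form \<Rightarrow> ('m, 'e) tvec)) set" where
  "bracket_pairs A k = {(D, l). subbundle (diff_forms A k) D \<and> l \<in> bundle_maps_to_tangent A k D \<and>
     (\<forall>x. annihilator A D x = {0}) \<and>
     skew D l \<and>
     (\<forall>\<alpha>\<in>sections_of (diff_forms A k) D UNIV. \<forall>\<beta>\<in>sections_of (diff_forms A k) D UNIV.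
        form_bracket A l \<alpha> \<beta> \<in> sections_of (diff_forms A k) D UNIV \<and>
        (\<forall>x. l x (form_bracket A l \<alpha> \<beta> x)
             = lie_bracket A (\<lambda>y. l y (\<alpha> y)) (\<lambda>y. l y (\<beta> y)) x))}"


section \<open>The two assignments\<close>

definition pair_of_subbundle ::
  "('m \<Rightarrow> ('v \<times> 'w) set) \<Rightarrow> ('m \<Rightarrow> 'w set) \<times> ('m \<Rightarrow> 'w \<Rightarrow> 'v)" where
  "pair_of_subbundle L =
     (\<lambda>x. snd ` L x, \<lambda>x. restrict (fst \<circ> inv_into (L x) snd) (snd ` L x))"

definition subbundle_of_pair ::
  "('m \<Rightarrow> 'w set) \<times> ('m \<Rightarrow> 'w \<Rightarrow> 'v) \<Rightarrow> 'm \<Rightarrow> ('v \<times> 'w) set" where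
  "subbundle_of_pair P = (case P of (D, l) \<Rightarrow> \<lambda>x. {(l x \<alpha>, \<alpha>) | \<alpha>. \<alpha> \<in> D x})"

end

theory Submission
  imports Defs
begin

text \<open>
  If \<open>L\<close> is isotropic and \<open>(X, 0) \<in> L\<close>, then \<open>X\<close> lies in \<open>L\<^sup>\<bottom> \<inter> TM = 0\<close>; so \<open>pr\<^sub>2\<close> is injective on \<open>L\<close>
  and \<open>L\<close> is the graph of a map \<open>\<lambda>: D \<rightarrow> TM\<close>. Under this identification isotropy of \<open>L\<close> is skewness
  of \<open>\<lambda>\<close>, \<open>L\<^sup>\<bottom> \<inter> TM\<close> is the annihilator of \<open>D\<close>, and the Courant bracket of \<open>(\<lambda>\<alpha>, \<alpha>)\<close> and
  \<open>(\<lambda>\<beta>, \<beta>)\<close> is \<open>([\<lambda>\<alpha>, \<lambda>\<beta>], [\<alpha>, \<beta>]\<^sub>\<lambda>)\<close>. The analytic content is that \<open>\<lambda>\<close> is smooth, because the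
  coefficients of a smooth section in a smooth frame are smooth. The two expressions for the bracket
  agree by skewness and the Cartan formula \<open>L\<^sub>Y = i\<^sub>Y d + d i\<^sub>Y\<close>.\<close>

section \<open>Smooth functions\<close>

text \<open>The derivative at a point sees a full neighbourhood, so agreement on \<open>S\<close>
  passes to derivatives because \<open>S\<close> is open. The closure lemmas below use this to
  replace the derivative of a compound expression by an explicit formula.\<close>

lemma Ck_on_cong:
  assumes "open S" "\<And>p. p \<in> S \<Longrightarrow> f p = g p" "Ck_on n S f"
  shows "Ck_on n S g"
  using assms(2,3)
proof (induction n arbitrary: f g)
  case 0
  then show ?case using continuous_on_cong by auto
next
  case (Suc n)
  have der: "(g has_derivative frechet_derivative f (at p)) (at p)" if "p \<in> S" for p
    using Suc.prems that \<open>open S\<close>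
    by (auto intro!: has_derivative_transform_within_open[of f _ p UNIV S g] simp: frechet_derivative_works)
  then have eq: "frechet_derivative g (at p) = frechet_derivative f (at p)" if "p \<in> S" for p
    using frechet_derivative_at[OF der[OF that]] by simp
  have "Ck_on n S (\<lambda>p. frechet_derivative g (at p) v)" for v
    by (rule Suc.IH[of "\<lambda>p. frechet_derivative f (at p) v"]) (use Suc.prems(2) eq in simp_all)
  then show ?case
    using der by (auto simp: differentiable_def)
qed

lemma Ck_on_subset: "Ck_on n S f \<Longrightarrow> T \<subseteq> S \<Longrightarrow> Ck_on n T f"
  by (induction n arbitrary: f) (auto intro: continuous_on_subset)

lemma Ck_on_SucD: "Ck_on (Suc n) S f \<Longrightarrow> Ck_on n S f"
proof (induction n arbitrary: f)
  case 0
  then show ?case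
    by (auto intro!: continuous_at_imp_continuous_on differentiable_imp_continuous_within)
next
  case (Suc n)
  then have "Ck_on (Suc n) S (\<lambda>p. frechet_derivative f (at p) v)" for v
    unfolding Ck_on.simps(2)[of "Suc n"] by blast
  then have "Ck_on n S (\<lambda>p. frechet_derivative f (at p) v)" for v
    by (rule Suc.IH)
  with Suc.prems show ?case by simp
qed

text \<open>Local frames yield smoothness only near each point; this glues it.\<close>

lemma Ck_on_local:
  assumes "\<And>p. p \<in> S \<Longrightarrow> \<exists>T. open T \<and> p \<in> T \<and> Ck_on n T f"
  shows "Ck_on n S f"
  using assms
proof (induction n arbitrary: f)
  case 0
  then show ?case
    by (fastforce intro!: continuous_at_imp_continuous_on simp: continuous_on_eq_continuous_at)
next
  case (Suc n)
  have "Ck_on n S (\<lambda>p. frechet_derivative f (at p) v)" for v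
  proof (rule Suc.IH)
    fix p assume "p \<in> S"
    from Suc.prems[OF this] show "\<exists>T. open T \<and> p \<in> T \<and> Ck_on n T (\<lambda>p. frechet_derivative f (at p) v)"
      unfolding Ck_on.simps(2) by blast
  qed
  moreover have "f differentiable (at p)" if "p \<in> S" for p
    using Suc.prems[OF that] by auto
  ultimately show ?case by simp
qed

lemma Ck_on_const: "Ck_on n S (\<lambda>p. c)"
  by (induction n arbitrary: c) auto

lemma Ck_on_add:
  assumes "open S" "Ck_on n S f" "Ck_on n S g"
  shows "Ck_on n S (\<lambda>p. f p + g p)"
  using assms(2,3)
proof (induction n arbitrary: f g)
  case 0
  then show ?case by (auto intro: continuous_on_add)
next
  case (Suc n)
  have der: "((\<lambda>p. f p + g p) has_derivative
      (\<lambda>v. frechet_derivative f (at p) v + frechet_derivative g (at p) v)) (at p)"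
    if "p \<in> S" for p
    using Suc.prems that by (intro has_derivative_add) (auto simp: frechet_derivative_works)
  have "Ck_on n S (\<lambda>p. frechet_derivative (\<lambda>p. f p + g p) (at p) v)" for v
  proof (rule Ck_on_cong[OF assms(1)])
    show "Ck_on n S (\<lambda>p. frechet_derivative f (at p) v + frechet_derivative g (at p) v)"
      using Suc.prems by (intro Suc.IH) auto
  qed (simp add: frechet_derivative_at[OF der, symmetric])
  moreover have "(\<lambda>p. f p + g p) differentiable (at p)" if "p \<in> S" for p
    using der[OF that] by (auto simp: differentiable_def)
  ultimately show ?case by simp
qed

lemma Ck_on_scaleR:
  fixes f :: "'a::real_normed_vector \<Rightarrow> real" and g :: "'a \<Rightarrow> 'b::real_normed_vector"
  assumes "open S" "Ck_on n S f" "Ck_on n S g"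
  shows "Ck_on n S (\<lambda>p. f p *\<^sub>R g p)"
  using assms(2,3)
proof (induction n arbitrary: f g)
  case 0
  then show ?case by (auto intro: continuous_on_scaleR)
next
  case (Suc n)
  have der: "((\<lambda>p. f p *\<^sub>R g p) has_derivative
      (\<lambda>v. f p *\<^sub>R frechet_derivative g (at p) v + frechet_derivative f (at p) v *\<^sub>R g p)) (at p)"
    if "p \<in> S" for p
    using Suc.prems that by (intro has_derivative_scaleR) (auto simp: frechet_derivative_works)
  have "Ck_on n S (\<lambda>p. frechet_derivative (\<lambda>p. f p *\<^sub>R g p) (at p) v)" for v
  proof (rule Ck_on_cong[OF assms(1)])
    \<comment> \<open>Each term of the Leibniz rule keeps one factor undifferentiated.
      \<open>Ck_on_SucD\<close> lowers the order of that factor to \<open>n\<close>, so the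
      induction hypothesis covers both terms.\<close>
    show "Ck_on n S (\<lambda>p. f p *\<^sub>R frechet_derivative g (at p) v + frechet_derivative f (at p) v *\<^sub>R g p)"
      using Suc.prems Ck_on_SucD[OF Suc.prems(1)] Ck_on_SucD[OF Suc.prems(2)]
      by (intro Ck_on_add assms Suc.IH) auto
  qed (simp add: frechet_derivative_at[OF der, symmetric])
  moreover have "(\<lambda>p. f p *\<^sub>R g p) differentiable (at p)" if "p \<in> S" for p
    using der[OF that] by (auto simp: differentiable_def)
  ultimately show ?case by simp
qed

lemma Ck_on_inverse:
  fixes f :: "'a::real_normed_vector \<Rightarrow> real"
  assumes "open S" "\<And>p. p \<in> S \<Longrightarrow> f p \<noteq> 0" "Ck_on n S f"
  shows "Ck_on n S (\<lambda>p. inverse (f p))"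
  using assms(3)
proof (induction n)
  case 0
  then show ?case using assms(2) by (auto intro: continuous_on_inverse)
next
  case (Suc n)
  have der: "((\<lambda>p. inverse (f p)) has_derivative
      (\<lambda>v. - (inverse (f p) * frechet_derivative f (at p) v * inverse (f p)))) (at p)"
    if "p \<in> S" for p
    using Suc.prems that assms(2) by (intro Deriv.has_derivative_inverse) (auto simp: frechet_derivative_works)
  have "Ck_on n S (\<lambda>p. frechet_derivative (\<lambda>p. inverse (f p)) (at p) v)" for v
  proof (rule Ck_on_cong[OF assms(1)])
    \<comment> \<open>The derivative of \<open>1/f\<close> contains \<open>1/f\<close> itself, but
      only to order \<open>n\<close>, which is the induction hypothesis.\<close>
    show "Ck_on n S (\<lambda>p. (- 1) *\<^sub>R (inverse (f p) *\<^sub>R (inverse (f p) *\<^sub>R frechet_derivative f (at p) v)))"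
      using Suc.prems Suc.IH Ck_on_SucD[OF Suc.prems(1)]
      by (intro Ck_on_scaleR assms Ck_on_const) auto
  qed (simp add: frechet_derivative_at[OF der, symmetric])
  moreover have "(\<lambda>p. inverse (f p)) differentiable (at p)" if "p \<in> S" for p
    using der[OF that] by (auto simp: differentiable_def)
  ultimately show ?case by simp
qed

lemma frechet_derivative_uminus:
  assumes "f differentiable (at p)"
  shows "frechet_derivative (\<lambda>q. - f q) (at p) = (\<lambda>v. - frechet_derivative f (at p) v)"
  using frechet_derivative_at[OF has_derivative_minus] assms frechet_derivative_works by metis

section \<open>Closure properties of smooth functions\<close>

lemma smooth_on_cong:
  "open S \<Longrightarrow> (\<And>p. p \<in> S \<Longrightarrow> f p = g p) \<Longrightarrow> smooth_on S f \<Longrightarrow> smooth_on S g"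
  unfolding smooth_on_def by (intro allI Ck_on_cong[of S f g]) auto

lemma smooth_on_subset: "smooth_on S f \<Longrightarrow> T \<subseteq> S \<Longrightarrow> smooth_on T f"
  unfolding smooth_on_def by (intro allI Ck_on_subset[of _ S f T]) auto

lemma smooth_on_local:
  "(\<And>p. p \<in> S \<Longrightarrow> \<exists>T. open T \<and> p \<in> T \<and> smooth_on T f) \<Longrightarrow> smooth_on S f"
  unfolding smooth_on_def by (intro allI Ck_on_local) blast

lemma smooth_on_const: "smooth_on S (\<lambda>p. c)"
  by (simp add: smooth_on_def Ck_on_const)

lemma smooth_on_add:
  "open S \<Longrightarrow> smooth_on S f \<Longrightarrow> smooth_on S g \<Longrightarrow> smooth_on S (\<lambda>p. f p + g p)"
  by (simp add: smooth_on_def Ck_on_add)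

lemma smooth_on_scaleR:
  "open S \<Longrightarrow> smooth_on S f \<Longrightarrow> smooth_on S g \<Longrightarrow> smooth_on S (\<lambda>p. f p *\<^sub>R g p)"
  by (simp add: smooth_on_def Ck_on_scaleR)

lemma smooth_on_mult:
  fixes f g :: "'a::real_normed_vector \<Rightarrow> real"
  shows "open S \<Longrightarrow> smooth_on S f \<Longrightarrow> smooth_on S g \<Longrightarrow> smooth_on S (\<lambda>p. f p * g p)"
  using smooth_on_scaleR[of S f g] by simp

lemma smooth_on_diff:
  assumes "open S" "smooth_on S f" "smooth_on S g"
  shows "smooth_on S (\<lambda>p. f p - g p)"
  using smooth_on_add[OF assms(1,2) smooth_on_scaleR[OF assms(1) smooth_on_const[of S "-1"] assms(3)]]
  by simp

lemma smooth_on_divide: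
  fixes f g :: "'a::real_normed_vector \<Rightarrow> real"
  assumes "open S" "smooth_on S f" "smooth_on S g" "\<And>p. p \<in> S \<Longrightarrow> g p \<noteq> 0"
  shows "smooth_on S (\<lambda>p. f p / g p)"
  using assms unfolding divide_inverse
  by (intro smooth_on_mult) (auto simp: smooth_on_def Ck_on_inverse)

lemma smooth_on_sum:
  "open S \<Longrightarrow> (\<And>i. i \<in> I \<Longrightarrow> smooth_on S (f i)) \<Longrightarrow> smooth_on S (\<lambda>p. \<Sum>i\<in>I. f i p)"
  by (induction I rule: infinite_finite_induct) (auto intro: smooth_on_const smooth_on_add)

lemma smooth_on_imp_continuous_on: "smooth_on S f \<Longrightarrow> continuous_on S f"
  using Ck_on.simps(1) smooth_on_def by blast

lemma smooth_on_imp_differentiable: "smooth_on S f \<Longrightarrow> p \<in> S \<Longrightarrow> f differentiable (at p)"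
  unfolding smooth_on_def by (drule spec[of _ "Suc 0"]) simp

section \<open>Smoothness of the coefficients in a frame\<close>

text \<open>Gaussian elimination: a coordinate \<open>j\<close> at which the last frame vector does not vanish is used
  to remove that vector from the frame.\<close>

lemma smooth_coefficients:
  fixes f :: "nat \<Rightarrow> 'a::real_normed_vector \<Rightarrow> 'i \<Rightarrow> real"
  assumes "open S" "p0 \<in> S"
    and "\<And>i j. i < r \<Longrightarrow> smooth_on S (\<lambda>p. f i p j)"
    and "\<And>j. smooth_on S (\<lambda>p. g p j)"
    and "\<And>p j. p \<in> S \<Longrightarrow> g p j = (\<Sum>i<r. a i p * f i p j)"
    and "\<And>c i. (\<And>j. (\<Sum>i<r. c i * f i p0 j) = 0) \<Longrightarrow> i < r \<Longrightarrow> c i = 0"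
  shows "\<exists>T. open T \<and> p0 \<in> T \<and> T \<subseteq> S \<and> (\<forall>i<r. smooth_on T (a i))"
  using assms
proof (induction r arbitrary: f g S)
  case 0
  then show ?case by auto
next
  case (Suc r)
  note smooth = Suc.prems(3,4) and eq = Suc.prems(5) and indep = Suc.prems(6)
  \<comment> \<open>The last frame vector is nonzero at \<open>p0\<close>; otherwise the
    coefficients that are 1 at \<open>r\<close> and 0 elsewhere would violate independence.\<close>
  have "\<exists>j. f r p0 j \<noteq> 0"
    using indep[of "\<lambda>i. if i = r then 1 else 0" r] by auto
  then obtain j where j: "f r p0 j \<noteq> 0" by blast
  \<comment> \<open>Shrink the domain so that the pivot stays nonzero; continuity of this one
    coordinate makes the smaller set open.\<close>
  define S' where "S' = {p \<in> S. f r p j \<noteq> 0}"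
  have S': "open S'" "p0 \<in> S'" "S' \<subseteq> S"
    using continuous_open_preimage[OF smooth_on_imp_continuous_on[OF smooth(1)[of r j]] Suc.prems(1), of "- {0}"]
      j Suc.prems(2)
    by (auto simp: S'_def vimage_def Int_def)
  have smooth'_f: "smooth_on S' (\<lambda>p. f i p l)" if "i < Suc r" for i l
    using smooth(1)[OF that] S'(3) smooth_on_subset by blast
  have smooth'_g: "smooth_on S' (\<lambda>p. g p l)" for l
    using smooth(2) S'(3) smooth_on_subset by blast
  note smooth' = smooth'_f smooth'_g
  have nz: "f r p j \<noteq> 0" if "p \<in> S'" for p
    using that by (simp add: S'_def)
  \<comment> \<open>Subtract the multiple of the last vector that kills coordinate \<open>j\<close>.
    The old coefficients \<open>a i\<close> with \<open>i < r\<close> still express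
    \<open>g'\<close> in the reduced frame.\<close>
  define f' where "f' i p l = f i p l - f i p j / f r p j * f r p l" for i p l
  define g' where "g' p l = g p l - g p j / f r p j * f r p l" for p l
  have "\<exists>T. open T \<and> p0 \<in> T \<and> T \<subseteq> S' \<and> (\<forall>i<r. smooth_on T (a i))"
  proof (rule Suc.IH[of S' f' g'])
    show "smooth_on S' (\<lambda>p. f' i p l)" if "i < r" for i l
      unfolding f'_def using that nz by (intro smooth_on_diff smooth_on_mult smooth_on_divide S' smooth') auto
    show "smooth_on S' (\<lambda>p. g' p l)" for l
      unfolding g'_def using nz by (intro smooth_on_diff smooth_on_mult smooth_on_divide S' smooth') auto
    show "g' p l = (\<Sum>i<r. a i p * f' i p l)" if "p \<in> S'" for p l
    proof -
      have "g' p l = (\<Sum>i<r. a i p * f i p l) + a r p * f r p l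
          - ((\<Sum>i<r. a i p * f i p j) + a r p * f r p j) / f r p j * f r p l"
        using eq[of p] that S'(3) by (simp add: g'_def subset_iff)
      also have "\<dots> = (\<Sum>i<r. a i p * f i p l) - (\<Sum>i<r. a i p * f i p j) * (f r p l / f r p j)"
        using nz[OF that] by (simp add: field_simps)
      also have "\<dots> = (\<Sum>i<r. a i p * f' i p l)"
       
            unfolding f'_def sum_distrib_right sum_subtractf[symmetric] by (intro sum.cong) (auto simp: algebra_simps)
      finally show ?thesis .
    qed
    show "c i = 0" if c: "\<And>l. (\<Sum>i<r. c i * f' i p0 l) = 0" and "i < r" for c i
    proof -
      \<comment> \<open>A relation among the reduced vectors lifts to the original ones; the last
        coefficient is chosen to cancel coordinate \<open>j\<close>.\<close>
      define c' where "c' i = (if i = r then - (\<Sum>i<r. c i * f i p0 j) / f r p0 j else c i)" for i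
      have "(\<Sum>i<Suc r. c' i * f i p0 l) = (\<Sum>i<r. c i * f' i p0 l)" for l
      proof -
        have "(\<Sum>i<r. c i * f' i p0 l) =
            (\<Sum>i<r. c i * f i p0 l) - (\<Sum>i<r. c i * f i p0 j) * (f r p0 l / f r p0 j)"
         
            unfolding f'_def sum_distrib_right sum_subtractf[symmetric] by (intro sum.cong) (auto simp: algebra_simps)
        moreover have "(\<Sum>i<r. c' i * f i p0 l) = (\<Sum>i<r. c i * f i p0 l)"
          by (rule sum.cong) (auto simp: c'_def)
        ultimately show ?thesis by (simp add: c'_def)
      qed
      then have "c' i = 0" using indep[of c' i] c \<open>i < r\<close> by simp
      then show ?thesis using \<open>i < r\<close> by (simp add: c'_def)
    qed
  qed (use S' in auto)
  then obtain T where T: "open T" "p0 \<in> T" "T \<subseteq> S'" "\<And>i. i < r \<Longrightarrow> smooth_on T (a i)" by blast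
  \<comment> \<open>Once the other coefficients are smooth, the equation at coordinate
    \<open>j\<close> is solved for the last one.\<close>
  have "smooth_on T (\<lambda>p. (g p j - (\<Sum>i<r. a i p * f i p j)) / f r p j)"
    using T nz smooth'_f[THEN smooth_on_subset, OF _ T(3)] smooth'_g[THEN smooth_on_subset, OF T(3)]
    by (intro smooth_on_divide smooth_on_diff smooth_on_sum smooth_on_mult) auto
  moreover have "a r p = (g p j - (\<Sum>i<r. a i p * f i p j)) / f r p j" if "p \<in> T" for p
  proof -
    have "p \<in> S'" "p \<in> S" using that T(3) S'(3) by auto
    with eq[of p j] nz[of p] show ?thesis by (simp add: field_simps)
  qed
  ultimately have "smooth_on T (a r)"
    by (auto intro: smooth_on_cong[OF T(1)])
  then show ?case using T S'(3) by (auto simp: less_Suc_eq)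
qed

section \<open>Finite-dimensional normed spaces\<close>

text \<open>Induction on the basis. The bound for \<open>B\<close> makes \<open>span B\<close>
  closed, so the new vector \<open>b\<close> has positive distance \<open>d\<close> from it. This
  controls the coefficient of \<open>b\<close>; subtracting the \<open>b\<close> part leaves a
  vector to which the bound for \<open>B\<close> applies.\<close>

lemma norm_sum_bounds_coefficients:
  fixes B :: "'a::real_normed_vector set"
  assumes "finite B" "independent B"
  shows "\<exists>C. \<forall>c. \<forall>b\<in>B. \<bar>c b\<bar> \<le> C * norm (\<Sum>b\<in>B. c b *\<^sub>R b)"
  using assms
proof (induction B)
  case empty
  then show ?case by simp
next
  case (insert b B)
  then have b: "b \<notin> span B" and "independent B"
    by (auto simp: independent_insert)
  then obtain C where C: "\<And>c e. e \<in> B \<Longrightarrow> \<bar>c e\<bar> \<le> C * norm (\<Sum>b\<in>B. c b *\<^sub>R b)"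
    using insert.IH by blast
  \<comment> \<open>The constant \<open>C\<close> may be negative when \<open>B\<close> is empty;
    the monotonicity arguments below want a nonnegative one.\<close>
  define C' where "C' = max C 0"
  have C': "\<bar>c e\<bar> \<le> C' * norm (\<Sum>b\<in>B. c b *\<^sub>R b)" if "e \<in> B" for c e
    by (rule order_trans[OF C[OF that] mult_right_mono]) (auto simp: C'_def)
  \<comment> \<open>At distance 0, elements \<open>s n\<close> of \<open>span B\<close> would
    converge to \<open>- b\<close>. Their coefficients are Cauchy by the induction hypothesis, and
    the limits would write \<open>- b\<close> as a combination of \<open>B\<close>.\<close>
  have "\<exists>d>0. \<forall>c. d \<le> norm (b + (\<Sum>e\<in>B. c e *\<^sub>R e))"
  proof (rule ccontr)
    assume "\<not> ?thesis"
    then have "\<exists>c. norm (b + (\<Sum>e\<in>B. c e *\<^sub>R e)) < inverse (Suc n)" for n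
      by (metis not_le inverse_positive_iff_positive of_nat_0_less_iff zero_less_Suc)
    then obtain c where c: "\<And>n. norm (b + (\<Sum>e\<in>B. c n e *\<^sub>R e)) < inverse (Suc n)" by metis
    define s where "s n = (\<Sum>e\<in>B. c n e *\<^sub>R e)" for n
    have "(\<lambda>n. b + s n) \<longlonglongrightarrow> 0"
      by (rule tendsto_0_le[OF LIMSEQ_inverse_real_of_nat, of _ 1])
        (use c in \<open>auto intro!: always_eventually less_imp_le simp: s_def\<close>)
    then have "(\<lambda>n. (b + s n) - b) \<longlonglongrightarrow> 0 - b"
      by (intro tendsto_intros)
    then have lim: "s \<longlonglongrightarrow> - b" by simp
    have "Cauchy (\<lambda>n. c n e)" if "e \<in> B" for e
    proof (rule metric_CauchyI)
      fix r :: real assume "r > 0"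
      \<comment> \<open>The 1 is added because \<open>C'\<close> may be 0.\<close>
      then have "r / (C' + 1) > 0" by (simp add: C'_def add_nonneg_pos)
      then obtain N where N: "\<And>m n. m \<ge> N \<Longrightarrow> n \<ge> N \<Longrightarrow> dist (s m) (s n) < r / (C' + 1)"
        using metric_CauchyD[OF LIMSEQ_imp_Cauchy[OF lim]] by meson
      have "dist (c m e) (c n e) < r" if "m \<ge> N" "n \<ge> N" for m n
      proof -
        have "dist (c m e) (c n e) \<le> C' * dist (s m) (s n)"
          using C'[OF \<open>e \<in> B\<close>, of "\<lambda>e. c m e - c n e"]
          by (simp add: dist_norm s_def scaleR_left_diff_distrib sum_subtractf)
        also have "\<dots> \<le> (C' + 1) * dist (s m) (s n)"
          by (simp add: mult_right_mono)
        also have "\<dots> < r"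
          using N[OF that] by (simp add: C'_def field_simps add_nonneg_pos)
        finally show ?thesis .
      qed
      then show "\<exists>N. \<forall>m\<ge>N. \<forall>n\<ge>N. dist (c m e) (c n e) < r" by blast
    qed
    then obtain l where l: "\<And>e. e \<in> B \<Longrightarrow> (\<lambda>n. c n e) \<longlonglongrightarrow> l e"
      unfolding Cauchy_convergent_iff convergent_def by metis
    then have "s \<longlonglongrightarrow> (\<Sum>e\<in>B. l e *\<^sub>R e)"
      unfolding s_def[abs_def] by (intro tendsto_intros) auto
    then have "- b = (\<Sum>e\<in>B. l e *\<^sub>R e)"
      using LIMSEQ_unique lim by blast
    then have "- b \<in> span B" by (simp add: span_sum span_scale span_base)
    then show False using b span_neg by fastforce
  qed
  then obtain d where d: "d > 0" "\<And>c. d \<le> norm (b + (\<Sum>e\<in>B. c e *\<^sub>R e))" by blast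
  \<comment> \<open>Division by a nonzero \<open>c b\<close> normalises the coefficient of
    \<open>b\<close> to 1, where the distance bound applies.\<close>
  have bd: "d * \<bar>c b\<bar> \<le> norm (c b *\<^sub>R b + (\<Sum>e\<in>B. c e *\<^sub>R e))" for c
  proof (cases "c b = 0")
    case False
    have "c b *\<^sub>R b + (\<Sum>e\<in>B. c e *\<^sub>R e) = c b *\<^sub>R (b + (\<Sum>e\<in>B. (c e / c b) *\<^sub>R e))"
      using False by (simp add: scaleR_add_right scaleR_sum_right)
    then show ?thesis using mult_left_mono[OF d(2)[of "\<lambda>e. c e / c b"] abs_ge_zero[of "c b"]]
      by (simp add: mult.commute)
  qed simp
  \<comment> \<open>The first summand serves the coefficient of \<open>b\<close>, the second all
    others: removing the \<open>b\<close> part multiplies the norm by at most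
    \<open>1 + norm b * inverse d\<close>.\<close>
  define K where "K = inverse d + C' * (1 + norm b * inverse d)"
  have K: "inverse d \<le> K" "C' * (1 + norm b * inverse d) \<le> K"
    using d(1) by (auto simp: K_def C'_def)
  have "\<bar>c e\<bar> \<le> K * norm (\<Sum>e\<in>insert b B. c e *\<^sub>R e)" if "e \<in> insert b B" for c e
  proof -
    define w where "w = c b *\<^sub>R b + (\<Sum>e\<in>B. c e *\<^sub>R e)"
    have cb: "\<bar>c b\<bar> \<le> inverse d * norm w"
      using bd[of c] d(1) by (simp add: w_def field_simps)
    have "\<bar>c e\<bar> \<le> K * norm w"
    proof (cases "e = b")
      case True
      show ?thesis unfolding True
        by (rule order_trans[OF cb mult_right_mono]) (use K in auto)
    next
      case False
      then have "e \<in> B" using that by simp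
      have "norm (\<Sum>e\<in>B. c e *\<^sub>R e) = norm (w - c b *\<^sub>R b)" by (simp add: w_def)
      also have "\<dots> \<le> norm w + \<bar>c b\<bar> * norm b"
        by (metis norm_triangle_ineq4 norm_scaleR)
      also have "\<dots> \<le> norm w + inverse d * norm w * norm b"
        using cb by (simp add: mult_right_mono)
      also have "\<dots> = (1 + norm b * inverse d) * norm w" by (simp add: algebra_simps)
      finally have "\<bar>c e\<bar> \<le> C' * ((1 + norm b * inverse d) * norm w)"
        using C'[OF \<open>e \<in> B\<close>, of c] by (smt (verit) C'_def mult_left_mono max.cobounded2)
      also have "\<dots> \<le> K * norm w"
        using K(2) by (simp add: mult.assoc[symmetric] mult_right_mono)
      finally show ?thesis .
    qed
    then show ?thesis using insert.hyps by (simp add: w_def)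
  qed
  then show ?case by blast
qed

text \<open>Allows the coordinates of a moving vector to be differentiated. For \<open>b\<close> in
  \<open>B\<close> the bound is \<open>norm_sum_bounds_coefficients\<close>; for other
  \<open>b\<close> the representation is 0 by convention.\<close>

lemma bounded_linear_representation:
  fixes B :: "'a::real_normed_vector set"
  assumes "finite B" "independent B" "span B = UNIV"
  shows "bounded_linear (\<lambda>v. representation B v b)"
proof (cases "b \<in> B")
  case True
  obtain C where "\<And>c b. b \<in> B \<Longrightarrow> \<bar>c b\<bar> \<le> C * norm (\<Sum>b\<in>B. c b *\<^sub>R b)"
    using norm_sum_bounds_coefficients[OF assms(1,2)] by blast
  from this[OF True] have "\<bar>representation B v b\<bar> \<le> C * norm v" for v
    by (metis UNIV_I assms order_refl real_vector.sum_representation_eq)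
  then show ?thesis
    using assms by (intro bounded_linear_intro[of _ C])
      (auto simp: real_vector.representation_add real_vector.representation_scale mult.commute)
next
  case False
  then have "representation B v b = 0" for v
    using real_vector.representation_ne_zero by blast
  then show ?thesis by simp
qed

section \<open>Alternating forms\<close>

lemma alt_forms_zero: "\<alpha> \<in> alt_forms k S \<Longrightarrow> \<not> (length vs = k \<and> set vs \<subseteq> S) \<Longrightarrow> \<alpha> vs = 0"
  by (auto simp: alt_forms_def)

lemma subspace_alt_forms: "subspace (alt_forms k S)"
proof (rule subspaceI)
  show "0 \<in> alt_forms k S"
    unfolding alt_forms_def by (auto simp: zero_fun_def)
  show "\<alpha> + \<beta> \<in> alt_forms k S" if "\<alpha> \<in> alt_forms k S" "\<beta> \<in> alt_forms k S" for \<alpha> \<beta>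
    using that unfolding alt_forms_def by (auto simp: plus_fun_def algebra_simps)
  show "r *\<^sub>R \<alpha> \<in> alt_forms k S" if "\<alpha> \<in> alt_forms k S" for r \<alpha>
    using that unfolding alt_forms_def by (auto simp: scaleR_fun_def algebra_simps)
qed

text \<open>On lists of length other than \<open>k\<close> both sides are 0. On the others this is
  multilinearity, with the updated position written as a split of the list.\<close>

lemma alt_forms_linear:
  assumes "subspace S" "\<alpha> \<in> alt_forms k S" "set xs \<subseteq> S" "set ys \<subseteq> S" "u \<in> S" "w \<in> S"
  shows "\<alpha> (xs @ (r *\<^sub>R u + w) # ys) = r * \<alpha> (xs @ u # ys) + \<alpha> (xs @ w # ys)"
proof (cases "length (xs @ u # ys) = k")
  case True
  have "set (xs @ u # ys) \<subseteq> S" using assms by auto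
  then have "\<forall>i<k. \<forall>v\<in>S. \<forall>w\<in>S. \<forall>r. \<alpha> ((xs @ u # ys)[i := r *\<^sub>R v + w]) =
      r * \<alpha> ((xs @ u # ys)[i := v]) + \<alpha> ((xs @ u # ys)[i := w])"
    using assms(2) True unfolding alt_forms_def by blast
  from this[rule_format, of "length xs" u w r] show ?thesis
    using assms True by auto
next
  case False
  then show ?thesis using alt_forms_zero[OF assms(2)] by simp
qed

text \<open>Polarisation: expand the value with \<open>u + w\<close> in both adjacent places, which
  is 0, as are the two terms with a repeated vector.\<close>

lemma alt_forms_swap:
  assumes "subspace S" "\<alpha> \<in> alt_forms k S" "set xs \<subseteq> S" "set ys \<subseteq> S" "u \<in> S" "w \<in> S"
  shows "\<alpha> (xs @ u # w # ys) = - \<alpha> (xs @ w # u # ys)"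
proof -
  have diag: "\<alpha> (xs @ v # v # ys) = 0" if "v \<in> S" for v
  proof (cases "length (xs @ v # v # ys) = k")
    case True
    have "set (xs @ v # v # ys) \<subseteq> S" using assms that by auto
    then have "\<forall>i<k. \<forall>j<k. i \<noteq> j \<and> (xs @ v # v # ys) ! i = (xs @ v # v # ys) ! j \<longrightarrow> \<alpha> (xs @ v # v # ys) = 0"
      using assms(2) True unfolding alt_forms_def by blast
    from this[rule_format, of "length xs" "Suc (length xs)"] show ?thesis
      using True by (auto simp: nth_append)
  next
    case False
    then show ?thesis using alt_forms_zero[OF assms(2)] by simp
  qed
  have fst_add: "\<alpha> (xs @ (u + w) # z # ys) = \<alpha> (xs @ u # z # ys) + \<alpha> (xs @ w # z # ys)" if "z \<in> S" for z
    using alt_forms_linear[OF assms(1,2,3), of "z # ys" u w 1] assms that by simp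
  have snd_add: "\<alpha> (xs @ z # (u + w) # ys) = \<alpha> (xs @ z # u # ys) + \<alpha> (xs @ z # w # ys)" if "z \<in> S" for z
    using alt_forms_linear[OF assms(1,2), of "xs @ [z]" ys u w 1] assms that by simp
  have "u + w \<in> S" using assms by (simp add: subspace_add)
  then have "\<alpha> (xs @ u # u # ys) + \<alpha> (xs @ u # w # ys) + (\<alpha> (xs @ w # u # ys) + \<alpha> (xs @ w # w # ys)) = 0"
    using diag[of "u + w"] assms by (simp add: fst_add snd_add)
  then show ?thesis using diag assms by simp
qed

text \<open>Each neighbour that \<open>w\<close> passes costs one sign. The induction peels
  \<open>xs\<close> from the right, since its last entry is passed first.\<close>

lemma alt_forms_move_to_front:
  assumes "subspace S" "\<alpha> \<in> alt_forms k S" "set xs \<subseteq> S" "set ys \<subseteq> S" "w \<in> S"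
  shows "\<alpha> (xs @ w # ys) = (- 1) ^ length xs * \<alpha> (w # xs @ ys)"
  using assms(3,4)
proof (induction xs arbitrary: ys rule: rev_induct)
  case (snoc u xs)
  then have "\<alpha> (xs @ u # w # ys) = - \<alpha> (xs @ w # u # ys)"
    using assms by (intro alt_forms_swap) auto
  then show ?case using snoc.IH[of "u # ys"] snoc.prems by simp
qed simp

text \<open>Brings the terms of \<open>lie_deriv\<close>, where one argument is replaced, to the
  shape of the terms of \<open>ext_deriv\<close>, where one argument is omitted and a sign
  appears.\<close>

lemma alt_forms_update:
  assumes "subspace S" "\<alpha> \<in> alt_forms k S" "i < length vs" "set vs \<subseteq> S" "w \<in> S"
  shows "\<alpha> (vs[i := w]) = (- 1) ^ i * \<alpha> (w # take i vs @ drop (Suc i) vs)"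
  using alt_forms_move_to_front[OF assms(1,2), of "take i vs" "drop (Suc i) vs" w] assms
    set_take_subset[of i vs] set_drop_subset[of "Suc i" vs]
  by (auto simp: upd_conv_take_nth_drop min_def)

section \<open>The Cartan formula in coordinates\<close>

text \<open>Differentiability is given only for fixed arguments, so the moving argument
  \<open>y q\<close> is expanded in a finite basis. The result is a finite sum of products of real
  functions, to which the product rule applies.\<close>

lemma has_derivative_form_argument:
  fixes \<phi> :: "'e::real_normed_vector \<Rightarrow> 'e form"
  assumes "\<exists>B::'e set. finite B \<and> span B = UNIV"
    and S: "open S" "p \<in> S" "\<And>q. q \<in> S \<Longrightarrow> \<phi> q \<in> alt_forms k UNIV"
    and \<phi>: "\<And>vs. (\<lambda>q. \<phi> q vs) differentiable (at p)"
    and y: "y differentiable (at p)"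
  shows "((\<lambda>q. \<phi> q (y q # ws)) has_derivative
    (\<lambda>v. frechet_derivative (\<lambda>q. \<phi> q (y p # ws)) (at p) v
       + \<phi> p (frechet_derivative y (at p) v # ws))) (at p)"
proof -
  obtain B0 :: "'e set" where B0: "finite B0" "span B0 = UNIV" using assms(1) by blast
  obtain B where "B \<subseteq> B0" "independent B" "B0 \<subseteq> span B"
    by (rule real_vector.maximal_independent_subset)
  then have B: "finite B" "independent B" "span B = UNIV"
    using B0 finite_subset[of B B0] span_minimal[of B0 "span B"] by auto
  define R where "R = representation B"
  have R: "bounded_linear (\<lambda>v. R v b)" for b
    unfolding R_def by (rule bounded_linear_representation[OF B])
  have expand: "\<phi> q (u # ws) = (\<Sum>b\<in>B. R u b * \<phi> q (b # ws))" if "q \<in> S" for q u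
  proof -
    \<comment> \<open>The instance with both vectors 0 gives the value 0 at the zero vector; with it
      the instance with \<open>w = 0\<close> becomes homogeneity.\<close>
    have lin: "linear (\<lambda>u. \<phi> q (u # ws))"
      using alt_forms_linear[OF subspace_UNIV S(3)[OF that], of "[]" ws _ _ 1]
        alt_forms_linear[OF subspace_UNIV S(3)[OF that], of "[]" ws _ 0]
        alt_forms_linear[OF subspace_UNIV S(3)[OF that], of "[]" ws 0 0 1]
      by (intro linearI) auto
    have "u = (\<Sum>b\<in>B. R u b *\<^sub>R b)"
      unfolding R_def using B by (simp add: real_vector.sum_representation_eq)
    then have "\<phi> q (u # ws) = \<phi> q ((\<Sum>b\<in>B. R u b *\<^sub>R b) # ws)" by simp
    then show ?thesis
      by (simp add: linear_sum[OF lin] linear_scale[OF lin])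
  qed
  define D where "D b = frechet_derivative (\<lambda>q. \<phi> q (b # ws)) (at p)" for b
  \<comment> \<open>Stated for any \<open>z\<close> because it is used twice: the constant
    \<open>y p\<close> computes the derivative at a frozen argument, and \<open>y\<close> itself
    gives the claim.\<close>
  have der: "((\<lambda>q. \<phi> q (z q # ws)) has_derivative
      (\<lambda>v. \<Sum>b\<in>B. R (z p) b * D b v + R (z' v) b * \<phi> p (b # ws))) (at p)"
    if "(z has_derivative z') (at p)" for z z'
  proof (rule has_derivative_transform_within_open[OF _ S(1,2)])
    show "((\<lambda>q. \<Sum>b\<in>B. R (z q) b * \<phi> q (b # ws)) has_derivative
      (\<lambda>v. \<Sum>b\<in>B. R (z p) b * D b v + R (z' v) b * \<phi> p (b # ws))) (at p)"
      using \<phi> unfolding D_def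
      by (intro has_derivative_sum has_derivative_mult bounded_linear.has_derivative[OF R] that)
        (simp add: frechet_derivative_works)
  qed (simp add: expand)
  have "R 0 b = 0" for b
    using linear_0[OF bounded_linear.linear[OF R]] .
  then have D: "frechet_derivative (\<lambda>q. \<phi> q (y p # ws)) (at p) = (\<lambda>v. \<Sum>b\<in>B. R (y p) b * D b v)"
    using frechet_derivative_at[OF der[OF has_derivative_const[of "y p"]]] by simp
  have "(y has_derivative frechet_derivative y (at p)) (at p)"
    using y by (simp add: frechet_derivative_works)
  from der[OF this] show ?thesis
    by (simp add: D expand[OF S(2), of "frechet_derivative y (at p) _"] sum.distrib)
qed

lemma cartan_formula_coordinates:
  fixes \<phi> :: "'e::real_normed_vector \<Rightarrow> 'e form"
  assumes "\<exists>B::'e set. finite B \<and> span B = UNIV"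
    and "open S" "p \<in> S" and alt: "\<And>q. q \<in> S \<Longrightarrow> \<phi> q \<in> alt_forms k UNIV"
    and "\<And>vs. (\<lambda>q. \<phi> q vs) differentiable (at p)" "y differentiable (at p)"
  shows "frechet_derivative (\<lambda>q. \<phi> q vs) (at p) (y p)
      + (\<Sum>i<length vs. \<phi> p (vs[i := frechet_derivative y (at p) (vs ! i)]))
    = (\<Sum>i<length (y p # vs). (- 1) ^ i * frechet_derivative
         (\<lambda>q. \<phi> q (take i (y p # vs) @ drop (Suc i) (y p # vs))) (at p) ((y p # vs) ! i))
      + (\<Sum>i<length vs. (- 1) ^ i * frechet_derivative
         (\<lambda>q. \<phi> q (y q # take i vs @ drop (Suc i) vs)) (at p) (vs ! i))"
proof -
  let ?ws = "\<lambda>i. take i vs @ drop (Suc i) vs"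
  let ?y' = "\<lambda>i. frechet_derivative y (at p) (vs ! i)"
  have d: "frechet_derivative (\<lambda>q. \<phi> q (y q # ?ws i)) (at p) (vs ! i) =
      frechet_derivative (\<lambda>q. \<phi> q (y p # ?ws i)) (at p) (vs ! i) + \<phi> p (?y' i # ?ws i)" for i
    using frechet_derivative_at[OF has_derivative_form_argument[OF assms], of "?ws i"]
    by (metis (no_types, lifting))
  have upd: "\<phi> p (vs[i := ?y' i]) = (- 1) ^ i * \<phi> p (?y' i # ?ws i)" if "i < length vs" for i
    using alt_forms_update[OF subspace_UNIV alt[OF assms(3)] that] by simp
  show ?thesis
    by (simp add: d upd sum.lessThan_Suc_shift sum.distrib distrib_left sum_negf del: sum.lessThan_Suc)
qed

section \<open>Fibres in a chart\<close>

locale atlas =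
  fixes A :: "('m::{t2_space, second_countable_topology}, 'e::real_normed_vector) chart set"
  assumes smooth_manifold: "smooth_manifold A"
begin

lemma finite_dim: "\<exists>B::'e set. finite B \<and> span B = UNIV"
  using smooth_manifold by (simp add: smooth_manifold_def)

lemma is_chart: "c \<in> A \<Longrightarrow> is_chart c"
  using smooth_manifold by (simp add: smooth_manifold_def)

lemma chart_at: "chart_at A x \<in> A" "x \<in> fst (chart_at A x)"
proof -
  have "\<exists>c. c \<in> A \<and> x \<in> fst c"
    using smooth_manifold unfolding smooth_manifold_def by blast
  from someI_ex[OF this] show "chart_at A x \<in> A" "x \<in> fst (chart_at A x)"
    by (auto simp: chart_at_def)
qed

lemma crd_inv_crd [simp]: "c \<in> A \<Longrightarrow> x \<in> fst c \<Longrightarrow> inv_into (fst c) (snd c) (snd c x) = x"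
  using is_chart[of c] by (auto simp: is_chart_def homeomorphism_def)

lemma open_crd_image:
  assumes "c \<in> A" "open W"
  shows "open (snd c ` (fst c \<inter> W))"
proof -
  have "openin (top_of_set (snd c ` fst c)) (snd c ` (fst c \<inter> W))"
    using is_chart[OF assms(1)] assms(2)
    by (auto simp: is_chart_def intro!: homeomorphism_imp_open_map openin_open_Int)
  then show ?thesis
    using is_chart[OF assms(1)] openin_open_trans by (auto simp: is_chart_def)
qed

lemma transition_differentiable:
  assumes "c \<in> A" "c' \<in> A" "x \<in> fst c" "x \<in> fst c'"
  shows "(snd c' \<circ> inv_into (fst c) (snd c)) differentiable (at (snd c x))"
  using smooth_manifold assms
  by (intro smooth_on_imp_differentiable[of "snd c ` (fst c \<inter> fst c')"])
    (auto simp: smooth_manifold_def)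

lemma linear_coord_vec:
  assumes "c \<in> A" "x \<in> fst c"
  shows "linear (coord_vec A c x)"
proof -
  have "linear (frechet_derivative (snd c' \<circ> inv_into (fst c) (snd c)) (at (snd c x)))"
    if "c' \<in> A" "x \<in> fst c'" for c'
    by (intro linear_frechet_derivative transition_differentiable assms that)
  then show ?thesis
    by (intro linearI ext) (auto simp: coord_vec_def plus_fun_def scaleR_fun_def linear_add linear_scale)
qed

text \<open>The change of coordinates from \<open>c\<close> to itself is known to be the identity on
  the image of the chart domain; as that image is open, this determines its derivative.\<close>

lemma coord_vec_same [simp]:
  assumes "c \<in> A" "x \<in> fst c"
  shows "coord_vec A c x v c = v"
proof -
  have "((snd c \<circ> inv_into (fst c) (snd c)) has_derivative (\<lambda>v. v)) (at (snd c x))"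
    by (rule has_derivative_transform_within_open[OF has_derivative_ident open_crd_image[of c UNIV]])
      (use assms in auto)
  from frechet_derivative_at[OF this] show ?thesis
    using assms by (simp add: coord_vec_def fun_eq_iff)
qed

text \<open>Chain rule for changes of coordinates. The composite through \<open>c'\<close> is
  compared with the direct change on the image of the overlap of \<open>c\<close> and
  \<open>c'\<close>, an open neighbourhood of the point.\<close>

lemma coord_vec_coord_vec:
  assumes "c \<in> A" "x \<in> fst c" "c' \<in> A" "x \<in> fst c'"
  shows "coord_vec A c' x (coord_vec A c x v c') = coord_vec A c x v"
proof
  fix c''
  let ?i = "inv_into (fst c) (snd c)" and ?i' = "inv_into (fst c') (snd c')"
  show "coord_vec A c' x (coord_vec A c x v c') c'' = coord_vec A c x v c''"
  proof (cases "c'' \<in> A \<and> x \<in> fst c''")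
    case True
    let ?D = "frechet_derivative (snd c'' \<circ> ?i') (at (snd c' x)) \<circ>
      frechet_derivative (snd c' \<circ> ?i) (at (snd c x))"
    have "((snd c'' \<circ> ?i') \<circ> (snd c' \<circ> ?i) has_derivative ?D) (at (snd c x))"
      using transition_differentiable[of c c' x] transition_differentiable[of c' c'' x] assms True
      by (intro diff_chain_at) (auto simp: frechet_derivative_works)
    then have "(snd c'' \<circ> ?i has_derivative ?D) (at (snd c x))"
      by (rule has_derivative_transform_within_open[OF _ open_crd_image[of c "fst c'"]])
        (use assms is_chart[of c'] in \<open>auto simp: is_chart_def\<close>)
    from frechet_derivative_at[OF this] show ?thesis
      using assms True by (simp add: coord_vec_def o_def fun_eq_iff)
  qed (auto simp: coord_vec_def)
qed

lemma coord_vec_in_tangent_space: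
  assumes "c \<in> A" "x \<in> fst c"
  shows "coord_vec A c x v \<in> tangent_space A x"
  unfolding tangent_space_def using assms by (auto simp: coord_vec_coord_vec) (auto simp: coord_vec_def)

lemma coord_vec_tangent:
  assumes "V \<in> tangent_space A x" "c \<in> A" "x \<in> fst c"
  shows "coord_vec A c x (V c) = V"
  using assms by (simp add: tangent_space_def)

text \<open>One chart around \<open>x\<close> exhibits the tangent space as the image of the model
  space under a linear map.\<close>

lemma subspace_tangent_space: "subspace (tangent_space A x)"
proof -
  have "tangent_space A x = range (coord_vec A (chart_at A x) x)"
  proof
    show "tangent_space A x \<subseteq> range (coord_vec A (chart_at A x) x)"
      using coord_vec_tangent[OF _ chart_at] by (metis rangeI subsetI)
  qed (use coord_vec_in_tangent_space[OF chart_at] in auto)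
  then show ?thesis
    using linear_subspace_image[OF linear_coord_vec[OF chart_at] subspace_UNIV] by simp
qed

lemma local_form_crd:
  assumes "c \<in> A" "x \<in> fst c"
  shows "local_form A c \<alpha> (snd c x) vs = \<alpha> x (map (coord_vec A c x) vs)"
  using assms by (simp add: local_form_def)

lemma local_form_tangent:
  assumes "c \<in> A" "x \<in> fst c" "set Vs \<subseteq> tangent_space A x"
  shows "local_form A c \<alpha> (snd c x) (map (\<lambda>V. V c) Vs) = \<alpha> x Vs"
proof -
  have "map (\<lambda>V. coord_vec A c x (V c)) Vs = Vs"
    using assms(3) coord_vec_tangent[OF _ assms(1,2)] by (intro map_idI) auto
  then show ?thesis using assms by (simp add: local_form_crd o_def)
qed

text \<open>The coordinate expression is the pullback of the form along the linear map
  \<open>coord_vec A c x\<close> into the tangent space, and pullback preserves multilinearity and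
  alternation.\<close>

lemma local_form_in_alt_forms:
  assumes "c \<in> A" "x \<in> fst c" "\<alpha> x \<in> cotangent_power A k x"
  shows "local_form A c \<alpha> (snd c x) \<in> alt_forms k UNIV"
proof -
  have tan: "set (map (coord_vec A c x) vs) \<subseteq> tangent_space A x" for vs
    using coord_vec_in_tangent_space[OF assms(1,2)] by auto
  have len: "\<alpha> x (map (coord_vec A c x) vs) = 0" if "length vs \<noteq> k" for vs
    using alt_forms_zero[OF assms(3)] that by simp
  have lin: "\<alpha> x ((map (coord_vec A c x) vs)[i := r *\<^sub>R coord_vec A c x u + coord_vec A c x w]) =
      r * \<alpha> x ((map (coord_vec A c x) vs)[i := coord_vec A c x u])
      + \<alpha> x ((map (coord_vec A c x) vs)[i := coord_vec A c x w])"
    if "length vs = k" "i < k" for vs i r u w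
  proof -
    have "length (map (coord_vec A c x) vs) = k" using that by simp
    with tan[of vs] have "\<forall>i<k. \<forall>U\<in>tangent_space A x. \<forall>W\<in>tangent_space A x. \<forall>r.
        \<alpha> x ((map (coord_vec A c x) vs)[i := r *\<^sub>R U + W]) =
        r * \<alpha> x ((map (coord_vec A c x) vs)[i := U]) + \<alpha> x ((map (coord_vec A c x) vs)[i := W])"
      using assms(3) unfolding alt_forms_def by blast
    then show ?thesis
      using that(2) coord_vec_in_tangent_space[OF assms(1,2)] by blast
  qed
  have alt: "\<alpha> x (map (coord_vec A c x) vs) = 0"
    if "length vs = k" "i < k" "j < k" "i \<noteq> j" "vs ! i = vs ! j" for vs i j
  proof -
    have "length (map (coord_vec A c x) vs) = k" using that by simp
    with tan[of vs] have "\<forall>i<k. \<forall>j<k. i \<noteq> j \<and> map (coord_vec A c x) vs ! i = map (coord_vec A c x) vs ! j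
        \<longrightarrow> \<alpha> x (map (coord_vec A c x) vs) = 0"
      using assms(3) unfolding alt_forms_def by blast
    then show ?thesis using that by auto
  qed
  show ?thesis
    unfolding alt_forms_def using assms(1,2)
    by (auto simp: local_form_crd len lin alt map_update
        linear_add[OF linear_coord_vec] linear_scale[OF linear_coord_vec])
qed

section \<open>The Cartan formula\<close>

text \<open>In coordinates, contraction with a field inserts a moving first argument, the situation
  of \<open>has_derivative_form_argument\<close>.\<close>

lemma local_form_interior_prod:
  assumes "c \<in> A" "p \<in> snd c ` fst c" "\<And>x. Y x \<in> tangent_space A x"
  shows "local_form A c (\<lambda>y. interior_prod (Y y) (\<alpha> y)) p vs = local_form A c \<alpha> p (local_vec c Y p # vs)"
  using assms by (auto simp: local_form_crd interior_prod_def local_vec_def coord_vec_tangent)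

context
  fixes \<alpha> :: "'m \<Rightarrow> ('m, 'e) tvec form" and Y :: "'m \<Rightarrow> ('m, 'e) tvec" and k :: nat
  assumes \<alpha>: "\<alpha> \<in> diff_forms A k UNIV" and Y: "Y \<in> vector_fields A UNIV"
begin

lemma local_form_differentiable:
  "c \<in> A \<Longrightarrow> x \<in> fst c \<Longrightarrow> (\<lambda>p. local_form A c \<alpha> p vs) differentiable (at (snd c x))"
  using \<alpha> by (intro smooth_on_imp_differentiable[of "snd c ` (fst c \<inter> UNIV)"]) (auto simp: diff_forms_def)

lemma local_vec_differentiable:
  "c \<in> A \<Longrightarrow> x \<in> fst c \<Longrightarrow> local_vec c Y differentiable (at (snd c x))"
  using Y by (intro smooth_on_imp_differentiable[of "snd c ` (fst c \<inter> UNIV)"]) (auto simp: vector_fields_def)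

lemma vector_field_tangent: "Y x \<in> tangent_space A x"
  using Y by (simp add: vector_fields_def)

lemma local_form_alt:
  "c \<in> A \<Longrightarrow> p \<in> snd c ` fst c \<Longrightarrow> local_form A c \<alpha> p \<in> alt_forms k UNIV"
  using \<alpha> by (auto simp: diff_forms_def intro: local_form_in_alt_forms)

text \<open>The product rule makes the contracted form differentiable in coordinates; its derivative
  is recorded in the shape used by the coordinate Cartan formula.\<close>

lemma has_derivative_local_form_interior_prod:
  assumes c: "c \<in> A" "x \<in> fst c"
  shows "((\<lambda>p. local_form A c (\<lambda>y. interior_prod (Y y) (\<alpha> y)) p vs) has_derivative
    frechet_derivative (\<lambda>p. local_form A c \<alpha> p (local_vec c Y p # vs)) (at (snd c x))) (at (snd c x))"
proof -
  have "open (snd c ` fst c)" using is_chart[OF c(1)] by (simp add: is_chart_def)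
  from has_derivative_form_argument[OF finite_dim this imageI[OF c(2)] local_form_alt[OF c(1)]
      local_form_differentiable[OF c] local_vec_differentiable[OF c]]
  have "(\<lambda>p. local_form A c \<alpha> p (local_vec c Y p # vs)) differentiable (at (snd c x))"
    by (rule differentiableI)
  then have "((\<lambda>p. local_form A c \<alpha> p (local_vec c Y p # vs)) has_derivative
    frechet_derivative (\<lambda>p. local_form A c \<alpha> p (local_vec c Y p # vs)) (at (snd c x))) (at (snd c x))"
    by (simp add: frechet_derivative_works)
  then show ?thesis
    by (rule has_derivative_transform_within_open[OF _ \<open>open (snd c ` fst c)\<close>])
      (use c vector_field_tangent in \<open>auto simp: local_form_interior_prod\<close>)
qed

text \<open>Both operators are evaluated in the one chart \<open>chart_at A x\<close>, so the
  coordinate identity there suffices. If some entry of \<open>Vs\<close> is not tangent, all terms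
  are 0 by definition.\<close>

lemma cartan_formula:
  "lie_deriv A Y \<alpha> x =
    interior_prod (Y x) (ext_deriv A \<alpha> x) + ext_deriv A (\<lambda>y. interior_prod (Y y) (\<alpha> y)) x"
proof
  fix Vs :: "('m, 'e) tvec list"
  define c where "c = chart_at A x"
  have c: "c \<in> A" "x \<in> fst c" using chart_at by (auto simp: c_def)
  define vs where "vs = map (\<lambda>V. V c) Vs"
  show "lie_deriv A Y \<alpha> x Vs =
    (interior_prod (Y x) (ext_deriv A \<alpha> x) + ext_deriv A (\<lambda>y. interior_prod (Y y) (\<alpha> y)) x) Vs"
  proof (cases "set Vs \<subseteq> tangent_space A x")
    case True
    have Yx: "local_vec c Y (snd c x) = Y x c"
      using c by (simp add: local_vec_def)
    have "open (snd c ` fst c)" using is_chart[OF c(1)] by (simp add: is_chart_def)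
    from cartan_formula_coordinates[OF finite_dim this imageI[OF c(2)] local_form_alt[OF c(1)]
        local_form_differentiable[OF c] local_vec_differentiable[OF c], of vs]
    show ?thesis
      unfolding plus_fun_apply interior_prod_def[of "Y x"] lie_deriv_def ext_deriv_def
      using True vector_field_tangent[of x]
      by (simp add: Let_def vs_def c_def[symmetric] Yx
          frechet_derivative_at[OF has_derivative_local_form_interior_prod[OF c], symmetric]
          del: sum.lessThan_Suc)
  qed (simp add: lie_deriv_def ext_deriv_def interior_prod_def)
qed

text \<open>\<open>frechet_derivative\<close> is a chosen value, so a sign is pulled out of it only
  at points of differentiability, which the contraction has by the product rule above.\<close>

lemma ext_deriv_uminus_interior_prod:
  "ext_deriv A (\<lambda>y. - interior_prod (Y y) (\<alpha> y)) x = - ext_deriv A (\<lambda>y. interior_prod (Y y) (\<alpha> y)) x"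
proof
  fix Vs :: "('m, 'e) tvec list"
  define c where "c = chart_at A x"
  have c: "c \<in> A" "x \<in> fst c" using chart_at by (auto simp: c_def)
  have "local_form A c (\<lambda>y. - interior_prod (Y y) (\<alpha> y)) =
      (\<lambda>p ws. - local_form A c (\<lambda>y. interior_prod (Y y) (\<alpha> y)) p ws)"
    by (simp add: local_form_def fun_eq_iff)
  then have "frechet_derivative (\<lambda>p. local_form A c (\<lambda>y. - interior_prod (Y y) (\<alpha> y)) p ws) (at (snd c x)) v
    = - frechet_derivative (\<lambda>p. local_form A c (\<lambda>y. interior_prod (Y y) (\<alpha> y)) p ws) (at (snd c x)) v" for ws v
    using frechet_derivative_uminus[OF differentiableI[OF has_derivative_local_form_interior_prod[OF c, of ws]]]
    by (simp add: fun_eq_iff)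
  then show "ext_deriv A (\<lambda>y. - interior_prod (Y y) (\<alpha> y)) x Vs = (- ext_deriv A (\<lambda>y. interior_prod (Y y) (\<alpha> y)) x) Vs"
    unfolding uminus_apply ext_deriv_def c_def[symmetric]
    by (simp add: Let_def sum_negf)
qed

end

end

section \<open>Frames\<close>

lemma sum_fun_apply: "(\<Sum>i\<in>I. f i) x = (\<Sum>i\<in>I. f i x)"
  for f :: "'i \<Rightarrow> 'a \<Rightarrow> 'b::comm_monoid_add"
  by (induction I rule: infinite_finite_induct) (auto simp: zero_fun_def)

text \<open>Passes from the image set in \<open>subbundle\<close> to coefficients indexed by
  \<open>i < r\<close>. The set forgets repetitions, which is why injectivity accompanies
  independence.\<close>

lemma independent_frame_iff:
  fixes F :: "nat \<Rightarrow> 'v::real_vector"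
  shows "inj_on F {..<r} \<and> independent (F ` {..<r}) \<longleftrightarrow>
    (\<forall>c. (\<Sum>i<r. c i *\<^sub>R F i) = 0 \<longrightarrow> (\<forall>i<r. c i = 0))" (is "?L \<longleftrightarrow> ?R")
proof
  assume L: ?L
  show ?R
  proof (intro allI impI)
    fix c :: "nat \<Rightarrow> real" and i
    assume c: "(\<Sum>i<r. c i *\<^sub>R F i) = 0" and i: "i < r"
    define u where "u v = c (inv_into {..<r} F v)" for v
    have u: "u (F i) = c i" if "i < r" for i
      using L that by (simp add: u_def)
    have "(\<Sum>v\<in>F ` {..<r}. u v *\<^sub>R v) = (\<Sum>i<r. u (F i) *\<^sub>R F i)"
      using L by (simp add: sum.reindex)
    also have "\<dots> = 0" using c u by simp
    finally have "u (F i) = 0"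
      using L i by (intro independentD[of "F ` {..<r}" "F ` {..<r}" u]) auto
    then show "c i = 0" using u i by simp
  qed
next
  assume R: ?R
  have inj: "inj_on F {..<r}"
  proof (rule inj_onI, rule ccontr)
    fix i j assume ij: "i \<in> {..<r}" "j \<in> {..<r}" "F i = F j" "i \<noteq> j"
    \<comment> \<open>Two equal vectors would satisfy this nontrivial relation.\<close>
    define c :: "nat \<Rightarrow> real" where "c l = (if l = i then 1 else 0) - (if l = j then 1 else 0)" for l
    have "(\<Sum>l<r. c l *\<^sub>R F l) = (\<Sum>l<r. (if l = i then F l else 0) - (if l = j then F l else 0))"
      by (rule sum.cong) (auto simp: c_def)
    also have "\<dots> = 0"
      using ij by (simp add: sum_subtractf sum.delta)
    finally have "c i = 0" using R ij by auto
    then show False using ij by (simp add: c_def)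
  qed
  moreover have "independent (F ` {..<r})"
  proof
    assume "dependent (F ` {..<r})"
    then obtain u where u: "\<exists>v\<in>F ` {..<r}. u v \<noteq> 0" "(\<Sum>v\<in>F ` {..<r}. u v *\<^sub>R v) = 0"
      using real_vector.dependent_finite[of "F ` {..<r}"] by auto
    then have "(\<Sum>i<r. u (F i) *\<^sub>R F i) = 0"
      using inj by (simp add: sum.reindex)
    then have "\<forall>i<r. u (F i) = 0" using R[THEN spec, of "\<lambda>i. u (F i)"] by simp
    then show False using u by auto
  qed
  ultimately show ?L by simp
qed

lemma span_frame: "span (F ` {..<r}) = range (\<lambda>c. \<Sum>i<r. c i *\<^sub>R F i)"
  for F :: "nat \<Rightarrow> 'v::real_vector"
proof
  show "span (F ` {..<r}) \<subseteq> range (\<lambda>c. \<Sum>i<r. c i *\<^sub>R F i)"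
  proof (rule span_minimal)
    show "F ` {..<r} \<subseteq> range (\<lambda>c. \<Sum>i<r. c i *\<^sub>R F i)"
    proof
      fix v assume "v \<in> F ` {..<r}"
      then obtain j where j: "j < r" "v = F j" by auto
      have "(\<Sum>i<r. (if i = j then 1 else 0) *\<^sub>R F i) = (\<Sum>i<r. if i = j then F i else 0)"
        by (rule sum.cong) auto
      then show "v \<in> range (\<lambda>c. \<Sum>i<r. c i *\<^sub>R F i)"
        using j rangeI[of "\<lambda>c. \<Sum>i<r. c i *\<^sub>R F i" "\<lambda>i. if i = j then 1 else 0"] by simp
    qed
    show "subspace (range (\<lambda>c. \<Sum>i<r. c i *\<^sub>R F i))"
    proof (rule subspaceI)
      show "0 \<in> range (\<lambda>c. \<Sum>i<r. c i *\<^sub>R F i)"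
        by (rule range_eqI[where x = "\<lambda>_. 0"]) simp
    next
      fix u v assume "u \<in> range (\<lambda>c. \<Sum>i<r. c i *\<^sub>R F i)" "v \<in> range (\<lambda>c. \<Sum>i<r. c i *\<^sub>R F i)"
      then obtain a b where "u = (\<Sum>i<r. a i *\<^sub>R F i)" "v = (\<Sum>i<r. b i *\<^sub>R F i)" by blast
      then have "u + v = (\<Sum>i<r. (a i + b i) *\<^sub>R F i)"
        by (simp add: scaleR_add_left sum.distrib)
      then show "u + v \<in> range (\<lambda>c. \<Sum>i<r. c i *\<^sub>R F i)"
        using rangeI[of "\<lambda>c. \<Sum>i<r. c i *\<^sub>R F i" "\<lambda>i. a i + b i"] by (simp only:)
    next
      fix s :: real and u assume "u \<in> range (\<lambda>c. \<Sum>i<r. c i *\<^sub>R F i)"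
      then obtain a where "u = (\<Sum>i<r. a i *\<^sub>R F i)" by blast
      then have "s *\<^sub>R u = (\<Sum>i<r. (s * a i) *\<^sub>R F i)"
        by (simp add: scaleR_sum_right)
      then show "s *\<^sub>R u \<in> range (\<lambda>c. \<Sum>i<r. c i *\<^sub>R F i)"
        using rangeI[of "\<lambda>c. \<Sum>i<r. c i *\<^sub>R F i" "\<lambda>i. s * a i"] by (simp only:)
    qed
  qed
  show "range (\<lambda>c. \<Sum>i<r. c i *\<^sub>R F i) \<subseteq> span (F ` {..<r})"
    by (rule image_subsetI, rule span_sum, rule span_scale, rule span_base) simp
qed

section \<open>Subbundles through local frames\<close>

lemma subbundle_iff:
  fixes L :: "'m::topological_space \<Rightarrow> 'v::real_vector set"
  shows "subbundle sec L \<longleftrightarrow> (\<forall>x. \<exists>W (r::nat) E. open W \<and> x \<in> W \<and> (\<forall>i<r. E i \<in> sec W) \<and>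
     (\<forall>y\<in>W. (\<forall>c. (\<Sum>i<r. c i *\<^sub>R E i y) = 0 \<longrightarrow> (\<forall>i<r. c i = 0)) \<and>
            range (\<lambda>c. \<Sum>i<r. c i *\<^sub>R E i y) = L y))"
proof -
  have "inj_on F {..<r} \<and> independent (F ` {..<r}) \<and> span (F ` {..<r}) = V \<longleftrightarrow>
      (\<forall>c. (\<Sum>i<r. c i *\<^sub>R F i) = 0 \<longrightarrow> (\<forall>i<r. c i = 0)) \<and> range (\<lambda>c. \<Sum>i<r. c i *\<^sub>R F i) = V"
    for F :: "nat \<Rightarrow> 'v" and r V
    unfolding span_frame independent_frame_iff[symmetric] by (rule conj_assoc[symmetric])
  then show ?thesis unfolding subbundle_def by (simp only:)
qed

lemma subbundle_frame:
  fixes L :: "'m::topological_space \<Rightarrow> 'v::real_vector set"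
  assumes "subbundle sec L"
  obtains W and r :: nat and E where "open W" "x \<in> W" "\<And>i. i < r \<Longrightarrow> E i \<in> sec W"
    "\<And>y c i. y \<in> W \<Longrightarrow> (\<Sum>i<r. c i *\<^sub>R E i y) = 0 \<Longrightarrow> i < r \<Longrightarrow> c i = 0"
    "\<And>y. y \<in> W \<Longrightarrow> L y = range (\<lambda>c. \<Sum>i<r. c i *\<^sub>R E i y)"
proof -
  from assms[unfolded subbundle_iff, THEN spec, of x]
  obtain W and r :: nat and E where *: "open W" "x \<in> W" "\<forall>i<r. E i \<in> sec W"
    and **: "\<forall>y\<in>W. (\<forall>c. (\<Sum>i<r. c i *\<^sub>R E i y) = 0 \<longrightarrow> (\<forall>i<r. c i = 0)) \<and>
            range (\<lambda>c. \<Sum>i<r. c i *\<^sub>R E i y) = L y"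
    by (elim exE conjE)
  show thesis
  proof (rule that[OF *(1,2)])
    show "E i \<in> sec W" if "i < r" for i using *(3) that by blast
    show "c i = 0" if "y \<in> W" "(\<Sum>i<r. c i *\<^sub>R E i y) = 0" "i < r" for y c i
      using bspec[OF ** that(1)] that(2,3) by blast
    show "L y = range (\<lambda>c. \<Sum>i<r. c i *\<^sub>R E i y)" if "y \<in> W" for y
      using bspec[OF ** that] by simp
  qed
qed

lemma subspace_subbundle:
  fixes L :: "'m::topological_space \<Rightarrow> 'v::real_vector set"
  assumes "subbundle sec L"
  shows "subspace (L x)"
proof -
  obtain W and r :: nat and E where "x \<in> W" and "\<And>y. y \<in> W \<Longrightarrow> L y = range (\<lambda>c. \<Sum>i<r. c i *\<^sub>R (E i y :: 'v))"
    by (rule subbundle_frame[OF assms, of x]) (rule that)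
  then show ?thesis
    using subspace_span[of "(\<lambda>i. E i x) ` {..<r}"] by (simp add: span_frame)
qed

text \<open>\<open>subbundle\<close> describes fibres only through frame sections, so containment in
  the ambient fibre \<open>V x\<close> is recovered from their values and linear
  combinations.\<close>

lemma subbundle_fibre_subset:
  fixes L :: "'m::topological_space \<Rightarrow> 'v::real_vector set"
  assumes "subbundle sec L" "subspace (V x)" "\<And>W E. E \<in> sec W \<Longrightarrow> x \<in> W \<Longrightarrow> E x \<in> V x"
  shows "L x \<subseteq> V x"
proof -
  obtain W and r :: nat and E where "x \<in> W" "\<And>i. i < r \<Longrightarrow> E i \<in> sec W"
    and L: "\<And>y. y \<in> W \<Longrightarrow> L y = range (\<lambda>c. \<Sum>i<r. c i *\<^sub>R (E i y :: 'v))"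
    by (rule subbundle_frame[OF assms(1), of x]) (rule that)
  then have "E i x \<in> V x" if "i < r" for i
    using assms(3) that by blast
  then have "(\<Sum>i<r. c i *\<^sub>R E i x) \<in> V x" for c
    using assms(2) by (auto intro!: subspace_sum subspace_scale)
  then show ?thesis using L[OF \<open>x \<in> W\<close>] by auto
qed

text \<open>A fibrewise injective linear map carries frames to frames. It serves both assignments:
  \<open>snd\<close> on \<open>L\<close> and the graph map on \<open>D\<close>. Linearity is asked
  on the fibres of \<open>L\<close> because a bundle map is \<open>undefined\<close> outside its
  fibres.\<close>

lemma subbundle_image:
  fixes T :: "'m::topological_space \<Rightarrow> 'v::real_vector \<Rightarrow> 'w::real_vector"
  assumes L: "subbundle sec L"
    and T: "\<And>x u v r. u \<in> L x \<Longrightarrow> v \<in> L x \<Longrightarrow> T x (r *\<^sub>R u + v) = r *\<^sub>R T x u + T x v"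
    and inj: "\<And>x. inj_on (T x) (L x)"
    and sec: "\<And>W E. open W \<Longrightarrow> E \<in> sections_of sec L W \<Longrightarrow> (\<lambda>x. T x (E x)) \<in> sec' W"
  shows "subbundle sec' (\<lambda>x. T x ` L x)"
  unfolding subbundle_iff
proof
  fix x
  obtain W and r :: nat and E where W: "open W" "x \<in> W" and E: "\<And>i. i < r \<Longrightarrow> E i \<in> sec W"
    and indep: "\<And>y c i. y \<in> W \<Longrightarrow> (\<Sum>i<r. c i *\<^sub>R E i y) = 0 \<Longrightarrow> i < r \<Longrightarrow> c i = 0"
    and Ly: "\<And>y. y \<in> W \<Longrightarrow> L y = range (\<lambda>c. \<Sum>i<r. c i *\<^sub>R E i y)"
    by (rule subbundle_frame[OF L, of x]) (rule that)
  have sub: "subspace (L y)" for y by (rule subspace_subbundle[OF L])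
  have EL: "E i y \<in> L y" if "i < r" "y \<in> W" for i y
    using that span_base[of "E i y" "(\<lambda>i. E i y) ` {..<r}"] by (simp add: span_frame Ly)
  have T0: "T y 0 = 0" for y
    using T[OF subspace_0[OF sub] subspace_0[OF sub], of y 1] by simp
  \<comment> \<open>Membership in \<open>L y\<close> is carried through the induction since
    \<open>T y\<close> is linear there.\<close>
  have Tsum: "(\<Sum>i<n. c i *\<^sub>R E i y) \<in> L y \<and> T y (\<Sum>i<n. c i *\<^sub>R E i y) = (\<Sum>i<n. c i *\<^sub>R T y (E i y))"
    if "y \<in> W" "n \<le> r" for y c n
    using that(2)
  proof (induction n)
    case 0
    then show ?case using T0 subspace_0[OF sub] by simp
  next
    case (Suc n)
    then show ?case
      using T[of "E n y" y "\<Sum>i<n. c i *\<^sub>R E i y" "c n"] EL[of n y] that(1) sub[of y]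
      by (simp add: subspace_add subspace_scale add.commute)
  qed
  have "c i = 0" if y: "y \<in> W" and c: "(\<Sum>i<r. c i *\<^sub>R T y (E i y)) = 0" "i < r" for y c i
  proof -
    have "(\<Sum>i<r. c i *\<^sub>R E i y) = 0"
      using Tsum[OF y order_refl, of c] c T0[of y] subspace_0[OF sub, of y] inj_onD[OF inj, of y] by metis
    then show ?thesis using indep y c(2) by blast
  qed
  moreover have "range (\<lambda>c. \<Sum>i<r. c i *\<^sub>R T y (E i y)) = T y ` L y" if y: "y \<in> W" for y
    unfolding Ly[OF y] image_image using Tsum[OF y order_refl] by simp
  moreover have "(\<lambda>y. T y (E i y)) \<in> sec' W" if "i < r" for i
    using E EL that W by (intro sec) (auto simp: sections_of_def)
  ultimately show "\<exists>W (r::nat) E. open W \<and> x \<in> W \<and> (\<forall>i<r. E i \<in> sec' W) \<and>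
     (\<forall>y\<in>W. (\<forall>c. (\<Sum>i<r. c i *\<^sub>R E i y) = 0 \<longrightarrow> (\<forall>i<r. c i = 0)) \<and>
            range (\<lambda>c. \<Sum>i<r. c i *\<^sub>R E i y) = T y ` L y)"
    using W by (intro exI[of _ W] exI[of _ r] exI[of _ "\<lambda>i y. T y (E i y)"]) blast
qed

section \<open>The two assignments\<close>

lemma pair_of_subbundle_apply:
  assumes "pair_of_subbundle L = (D, l)" "inj_on snd (L x)"
  shows "D x = snd ` L x" "u \<in> L x \<Longrightarrow> l x (snd u) = fst u"
  using assms by (auto simp: pair_of_subbundle_def)

lemma subbundle_of_pair_of_subbundle:
  assumes "\<And>x. inj_on snd (L x)"
  shows "subbundle_of_pair (pair_of_subbundle L) = L"
proof -
  obtain D l where P: "pair_of_subbundle L = (D, l)" by (cases "pair_of_subbundle L")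
  note DL = pair_of_subbundle_apply[OF P assms]
  show ?thesis
  proof
    fix x
    have "{(l x \<alpha>, \<alpha>) |\<alpha>. \<alpha> \<in> D x} = (\<lambda>u. (l x (snd u), snd u)) ` L x"
      by (auto simp: DL(1))
    also have "\<dots> = L x" by (simp add: DL(2))
    finally show "subbundle_of_pair (pair_of_subbundle L) x = L x"
      by (simp add: P subbundle_of_pair_def)
  qed
qed

lemma interior_prod_zero [simp]: "interior_prod X 0 = 0"
  by (simp add: interior_prod_def zero_fun_def)

context atlas
begin

lemma gen_subbundle_fibre:
  assumes "subbundle (gen_fields A k) L"
  shows "L x \<subseteq> tangent_space A x \<times> cotangent_power A k x"
  by (rule subbundle_fibre_subset[OF assms])
    (auto simp: gen_fields_def vector_fields_def diff_forms_def mem_Times_iff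
      intro: subspace_Times subspace_tangent_space subspace_alt_forms)

section \<open>Smoothness of the bundle map\<close>

text \<open>Expand \<open>(X, \<alpha>)\<close> in a local frame of \<open>L\<close>. Injectivity of
  \<open>snd\<close> keeps the form parts of the frame independent, so
  \<open>smooth_coefficients\<close> applied to \<open>\<alpha>\<close> makes the coefficients
  smooth, and the same coefficients express \<open>X\<close>.\<close>

lemma vector_field_of_form:
  assumes L: "subbundle (gen_fields A k) L" and inj: "\<And>x. inj_on snd (L x)"
    and W: "open W" and \<alpha>: "\<alpha> \<in> diff_forms A k W" and XL: "\<And>x. x \<in> W \<Longrightarrow> (X x, \<alpha> x) \<in> L x"
  shows "X \<in> vector_fields A W"
  unfolding vector_fields_def
proof (intro CollectI conjI ballI)
  show "X x \<in> tangent_space A x" if "x \<in> W" for x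
    using XL[OF that] gen_subbundle_fibre[OF L] by auto
next
  fix c assume c: "c \<in> A"
  show "smooth_on (snd c ` (fst c \<inter> W)) (local_vec c X)"
  proof (rule smooth_on_local)
    fix p assume "p \<in> snd c ` (fst c \<inter> W)"
    then obtain x where x: "x \<in> fst c" "x \<in> W" "p = snd c x" by blast
    obtain V and r :: nat and E where V: "open V" "x \<in> V" and E: "\<And>i. i < r \<Longrightarrow> E i \<in> gen_fields A k V"
      and indep: "\<And>y d i. y \<in> V \<Longrightarrow> (\<Sum>i<r. d i *\<^sub>R E i y) = 0 \<Longrightarrow> i < r \<Longrightarrow> d i = 0"
      and Ly: "\<And>y. y \<in> V \<Longrightarrow> L y = range (\<lambda>d. \<Sum>i<r. d i *\<^sub>R E i y)"
      by (rule subbundle_frame[OF L, of x]) (rule that)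
    have "\<exists>d. (X y, \<alpha> y) = (\<Sum>i<r. d i *\<^sub>R E i y)" if "y \<in> W \<inter> V" for y
      using XL[of y] Ly[of y] that by blast
    \<comment> \<open>The coefficients are chosen point by point; their smoothness comes from
      \<open>smooth_coefficients\<close> below.\<close>
    then have "\<exists>a. \<forall>y\<in>W \<inter> V. (X y, \<alpha> y) = (\<Sum>i<r. a y i *\<^sub>R E i y)"
      by (intro bchoice) blast
    then obtain a where a: "\<And>y. y \<in> W \<inter> V \<Longrightarrow> (X y, \<alpha> y) = (\<Sum>i<r. a y i *\<^sub>R E i y)"
      by blast
    have X_eq: "X y = (\<Sum>i<r. a y i *\<^sub>R fst (E i y))" and \<alpha>_eq: "\<alpha> y = (\<Sum>i<r. a y i *\<^sub>R snd (E i y))"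
      if "y \<in> W \<inter> V" for y
      using arg_cong[OF a[OF that], of fst] arg_cong[OF a[OF that], of snd] by (simp_all add: fst_sum snd_sum)
    define S where "S = snd c ` (fst c \<inter> (W \<inter> V))"
    have S: "open S" "p \<in> S"
      unfolding S_def using open_crd_image[OF c open_Int[OF W V(1)]] V x by auto
    \<comment> \<open>The coordinate index of \<open>smooth_coefficients\<close> is here the list of
      model vectors at which a form is evaluated.\<close>
    define F where "F i q = local_form A c (\<lambda>y. snd (E i y)) q" for i q
    have "\<exists>T. open T \<and> p \<in> T \<and> T \<subseteq> S \<and> (\<forall>i<r. smooth_on T (\<lambda>q. a (inv_into (fst c) (snd c) q) i))"
    proof (rule smooth_coefficients[OF S, where f = F and g = "local_form A c \<alpha>"])
      show "smooth_on S (\<lambda>q. F i q vs)" if "i < r" for i vs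
      proof -
        have "smooth_on (snd c ` (fst c \<inter> V)) (\<lambda>q. F i q vs)"
          using E[OF that] c by (simp add: gen_fields_def diff_forms_def F_def)
        then show ?thesis by (rule smooth_on_subset) (auto simp: S_def)
      qed
      show "smooth_on S (\<lambda>q. local_form A c \<alpha> q vs)" for vs
      proof -
        have "smooth_on (snd c ` (fst c \<inter> W)) (\<lambda>q. local_form A c \<alpha> q vs)"
          using \<alpha> c by (simp add: diff_forms_def)
        then show ?thesis by (rule smooth_on_subset) (auto simp: S_def)
      qed
      show "local_form A c \<alpha> q vs = (\<Sum>i<r. a (inv_into (fst c) (snd c) q) i * F i q vs)" if "q \<in> S" for q vs
      proof -
        from that obtain y where y: "y \<in> fst c" "y \<in> W \<inter> V" "q = snd c y" by (auto simp: S_def)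
        show ?thesis
          using c y(1) unfolding y(3) F_def
          by (simp add: local_form_crd \<alpha>_eq[OF y(2)] sum_fun_apply scaleR_fun_def)
      qed
      \<comment> \<open>A relation among the form parts at \<open>x\<close> yields an element of
        \<open>L x\<close> with zero form part. Injectivity of \<open>snd\<close> makes it 0, and
        independence of the frame applies.\<close>
      show "d i = 0" if d: "\<And>vs. (\<Sum>i<r. d i * F i p vs) = 0" and "i < r" for d i
      proof -
        have E_alt: "snd (E i x) \<in> cotangent_power A k x" if "i < r" for i
          using E[OF that] V by (auto simp: gen_fields_def diff_forms_def)
        have "(\<Sum>i<r. d i *\<^sub>R snd (E i x)) Vs = 0" for Vs
        proof (cases "set Vs \<subseteq> tangent_space A x")
          case True
          then show ?thesis
            using d[of "map (\<lambda>V. V c) Vs"] c x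
            by (simp add: F_def local_form_tangent sum_fun_apply scaleR_fun_def)
        next
          case False
          then show ?thesis
            using alt_forms_zero[OF E_alt] by (simp add: sum_fun_apply scaleR_fun_def)
        qed
        then have "snd (\<Sum>i<r. d i *\<^sub>R E i x) = 0"
          by (simp add: snd_sum fun_eq_iff)
        moreover have "(\<Sum>i<r. d i *\<^sub>R E i x) \<in> L x" using Ly[OF V(2)] by simp
        ultimately have "(\<Sum>i<r. d i *\<^sub>R E i x) = 0"
          using inj_onD[OF inj[of x], of _ 0] subspace_0[OF subspace_subbundle[OF L]] by simp
        then show ?thesis using indep V(2) \<open>i < r\<close> by blast
      qed
    qed
    then obtain T where T: "open T" "p \<in> T" "T \<subseteq> S"
      and aT: "\<And>i. i < r \<Longrightarrow> smooth_on T (\<lambda>q. a (inv_into (fst c) (snd c) q) i)" by blast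
    have ET: "smooth_on T (local_vec c (\<lambda>y. fst (E i y)))" if "i < r" for i
    proof -
      have "smooth_on (snd c ` (fst c \<inter> V)) (local_vec c (\<lambda>y. fst (E i y)))"
        using E[OF that] c by (simp add: gen_fields_def vector_fields_def)
      then show ?thesis by (rule smooth_on_subset) (use T(3) in \<open>auto simp: S_def\<close>)
    qed
    have "smooth_on T (\<lambda>q. \<Sum>i<r. a (inv_into (fst c) (snd c) q) i *\<^sub>R local_vec c (\<lambda>y. fst (E i y)) q)"
      using aT ET by (intro smooth_on_sum smooth_on_scaleR T) auto
    then have "smooth_on T (local_vec c X)"
    proof (rule smooth_on_cong[OF T(1), rotated])
      fix q assume "q \<in> T"
      then obtain y where y: "y \<in> fst c" "y \<in> W \<inter> V" "q = snd c y" using T(3) by (auto simp: S_def)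
      show "(\<Sum>i<r. a (inv_into (fst c) (snd c) q) i *\<^sub>R local_vec c (\<lambda>y. fst (E i y)) q) = local_vec c X q"
        using c y(1) unfolding y(3)
        by (simp add: local_vec_def X_eq[OF y(2)] sum_fun_apply scaleR_fun_def)
    qed
    then show "\<exists>T. open T \<and> p \<in> T \<and> smooth_on T (local_vec c X)" using T by blast
  qed
qed

lemma inj_on_snd_of_isotropic:
  assumes "L \<in> isotropic_involutive_subbundles A k"
  shows "inj_on snd (L x)"
proof (rule inj_onI)
  have L: "subbundle (gen_fields A k) L" "L x \<subseteq> orthogonal_fibre A k L x"
    "orthogonal_fibre A k L x \<inter> (tangent_space A x \<times> {0}) = {0}"
    using assms by (auto simp: isotropic_involutive_subbundles_def isotropic_def)
  fix u v assume uv: "u \<in> L x" "v \<in> L x" "snd u = snd v"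
  then have "u - v \<in> L x"
    using subspace_diff[OF subspace_subbundle[OF L(1)]] by blast
  moreover obtain X \<omega> where X: "u - v = (X, \<omega>)" by (cases "u - v")
  moreover have "\<omega> = 0" using X uv(3) by (metis diff_self snd_conv snd_diff)
  ultimately have "u - v \<in> orthogonal_fibre A k L x \<inter> (tangent_space A x \<times> {0})"
    using L(2) gen_subbundle_fibre[OF L(1), of x] by auto
  then show "u = v" using L(3) by simp
qed

text \<open>On \<open>D x\<close>, \<open>snd\<close> is injective on the graph, so
  \<open>inv_into\<close> returns the point above the given form. Outside \<open>D x\<close> both
  maps are \<open>undefined\<close>.\<close>

lemma pair_of_subbundle_of_pair:
  assumes "P \<in> bracket_pairs A k"
  shows "pair_of_subbundle (subbundle_of_pair P) = P"
proof -
  obtain D l where P: "P = (D, l)" by (cases P)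
  have l: "l x \<in> extensional (D x)" for x
    using assms by (auto simp: P bracket_pairs_def bundle_maps_to_tangent_def PiE_def)
  have D: "snd ` {(l x \<alpha>, \<alpha>) |\<alpha>. \<alpha> \<in> D x} = D x" for x by force
  have "fst (inv_into {(l x \<alpha>, \<alpha>) |\<alpha>. \<alpha> \<in> D x} snd \<beta>) = l x \<beta>" if "\<beta> \<in> D x" for x \<beta>
  proof -
    have "inv_into {(l x \<alpha>, \<alpha>) |\<alpha>. \<alpha> \<in> D x} snd (snd (l x \<beta>, \<beta>)) = (l x \<beta>, \<beta>)"
      using that by (intro inv_into_f_f inj_onI) auto
    then show ?thesis by simp
  qed
  then have "restrict (fst \<circ> inv_into {(l x \<alpha>, \<alpha>) |\<alpha>. \<alpha> \<in> D x} snd) (D x) = l x" for x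
    using l by (intro extensionalityI[of _ "D x"]) auto
  then show ?thesis
    by (simp add: P pair_of_subbundle_def subbundle_of_pair_def D)
qed

section \<open>From the subbundle to the pair\<close>

lemma pair_of_subbundle_in_bracket_pairs:
  assumes LI: "L \<in> isotropic_involutive_subbundles A k"
  shows "pair_of_subbundle L \<in> bracket_pairs A k"
proof -
  have L: "subbundle (gen_fields A k) L" and iso: "\<And>x. L x \<subseteq> orthogonal_fibre A k L x"
    and inv: "involutive A k L"
    and orth: "\<And>x. orthogonal_fibre A k L x \<inter> (tangent_space A x \<times> {0}) = {0}"
    using LI by (auto simp: isotropic_involutive_subbundles_def isotropic_def)
  note inj = inj_on_snd_of_isotropic[OF LI]
  obtain D l where P: "pair_of_subbundle L = (D, l)" by (cases "pair_of_subbundle L")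
  note DL = pair_of_subbundle_apply[OF P inj]
  note fibre = gen_subbundle_fibre[OF L]
  have memL: "(l x \<alpha>, \<alpha>) \<in> L x" if "\<alpha> \<in> D x" for x \<alpha>
  proof -
    from that obtain u where "u \<in> L x" "\<alpha> = snd u" by (auto simp: DL(1))
    then show ?thesis using DL(2) by simp
  qed
  have smooth: "(\<lambda>x. l x (\<alpha> x)) \<in> vector_fields A W"
    if "open W" "\<alpha> \<in> sections_of (diff_forms A k) D W" for W \<alpha>
    using that by (intro vector_field_of_form[OF L inj, of W \<alpha>]) (auto simp: sections_of_def memL)
  have "subbundle (diff_forms A k) (\<lambda>x. snd ` L x)"
    using L by (rule subbundle_image) (auto simp: inj sections_of_def gen_fields_def)
  moreover have "(\<lambda>x. snd ` L x) = D" by (simp add: DL(1) fun_eq_iff)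
  ultimately have sub: "subbundle (diff_forms A k) D" by simp
  have bm: "l \<in> bundle_maps_to_tangent A k D"
    unfolding bundle_maps_to_tangent_def
  proof (intro CollectI conjI allI ballI impI)
    fix x
    have "l x \<in> extensional (D x)" using P by (auto simp: pair_of_subbundle_def)
    then show "l x \<in> D x \<rightarrow>\<^sub>E tangent_space A x"
      using memL[of _ x] fibre[of x] by (auto simp: PiE_def)
    fix \<alpha> \<beta> r assume "\<alpha> \<in> D x" "\<beta> \<in> D x"
    then have "r *\<^sub>R (l x \<alpha>, \<alpha>) + (l x \<beta>, \<beta>) \<in> L x"
      using memL subspace_subbundle[OF L] by (intro subspace_add subspace_scale) auto
    from DL(2)[OF this] show "l x (r *\<^sub>R \<alpha> + \<beta>) = r *\<^sub>R l x \<alpha> + l x \<beta>" by simp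
  qed (rule smooth)
  \<comment> \<open>Pairing \<open>(X, 0)\<close> with an element of \<open>L\<close> contracts its
    form part with \<open>X\<close>, so orthogonality to \<open>L\<close> means annihilating
    \<open>D\<close>. That 0 annihilates is read off from \<open>(0, 0)\<close> being
    orthogonal.\<close>
  have ann: "annihilator A D x = {0}" for x
  proof -
    have "(X, 0) \<in> orthogonal_fibre A k L x" if "X \<in> annihilator A D x" for X
      using that subspace_0[OF subspace_alt_forms[of k "tangent_space A x"]]
      by (auto simp: orthogonal_fibre_def annihilator_def pairing_def DL(1))
    moreover have "X \<in> tangent_space A x" if "X \<in> annihilator A D x" for X
      using that by (simp add: annihilator_def)
    ultimately have "annihilator A D x \<subseteq> {0}"
      using orth[of x] by (auto simp: zero_prod_def)
    moreover have "(0, 0) \<in> orthogonal_fibre A k L x" using orth[of x] by (auto simp: zero_prod_def)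
    then have "0 \<in> annihilator A D x"
      by (auto simp: orthogonal_fibre_def annihilator_def pairing_def DL(1))
    ultimately show ?thesis by blast
  qed
  have skew: "skew D l"
    unfolding skew_def
  proof (intro allI ballI)
    fix x \<alpha> \<beta> assume "\<alpha> \<in> D x" "\<beta> \<in> D x"
    then have "(l x \<alpha>, \<alpha>) \<in> orthogonal_fibre A k L x" "(l x \<beta>, \<beta>) \<in> L x"
      using memL iso by blast+
    then have "pairing (l x \<alpha>, \<alpha>) (l x \<beta>, \<beta>) = 0"
      by (simp add: orthogonal_fibre_def)
    then show "interior_prod (l x \<alpha>) \<beta> = - interior_prod (l x \<beta>) \<alpha>"
      by (simp add: pairing_def eq_neg_iff_add_eq_0)
  qed
  have bracket: "form_bracket A l \<alpha> \<beta> \<in> sections_of (diff_forms A k) D UNIV \<and>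
      (\<forall>x. l x (form_bracket A l \<alpha> \<beta> x) = lie_bracket A (\<lambda>y. l y (\<alpha> y)) (\<lambda>y. l y (\<beta> y)) x)"
    if \<alpha>: "\<alpha> \<in> sections_of (diff_forms A k) D UNIV" and \<beta>: "\<beta> \<in> sections_of (diff_forms A k) D UNIV" for \<alpha> \<beta>
  proof -
    let ?s = "\<lambda>\<alpha> x. (l x (\<alpha> x), \<alpha> x)"
    have sec: "?s \<gamma> \<in> sections_of (gen_fields A k) L UNIV"
      if "\<gamma> \<in> sections_of (diff_forms A k) D UNIV" for \<gamma>
      using that smooth[OF open_UNIV that] memL by (auto simp: sections_of_def gen_fields_def)
    have br: "courant_bracket A (?s \<alpha>) (?s \<beta>) =
        (\<lambda>x. (lie_bracket A (\<lambda>y. l y (\<alpha> y)) (\<lambda>y. l y (\<beta> y)) x, form_bracket A l \<alpha> \<beta> x))"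
      by (simp add: courant_bracket_def form_bracket_def Let_def)
    have "courant_bracket A (?s \<alpha>) (?s \<beta>) \<in> sections_of (gen_fields A k) L UNIV"
      using inv sec \<alpha> \<beta> unfolding involutive_def by blast
    \<comment> \<open>Membership in \<open>L x\<close> says both that the form part lies in
      \<open>D x\<close> and that \<open>l x\<close> sends it to the vector part: the two halves of
      condition (c).\<close>
    then have "form_bracket A l \<alpha> \<beta> \<in> diff_forms A k UNIV"
      and mem: "(lie_bracket A (\<lambda>y. l y (\<alpha> y)) (\<lambda>y. l y (\<beta> y)) x, form_bracket A l \<alpha> \<beta> x) \<in> L x" for x
      unfolding br by (simp_all add: sections_of_def gen_fields_def)
    moreover have "form_bracket A l \<alpha> \<beta> x \<in> D x" for x
      using imageI[OF mem, of snd x] by (simp add: DL(1))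
    moreover have "l x (form_bracket A l \<alpha> \<beta> x) = lie_bracket A (\<lambda>y. l y (\<alpha> y)) (\<lambda>y. l y (\<beta> y)) x" for x
      using DL(2)[OF mem, of x] by simp
    ultimately show ?thesis by (simp add: sections_of_def)
  qed
  show ?thesis
    unfolding P bracket_pairs_def
    by (intro CollectI case_prodI conjI allI ballI sub bm ann skew)
      (use bracket in blast)+
qed

section \<open>From the pair to the subbundle\<close>

lemma subbundle_of_pair_in_isotropic_involutive:
  assumes "P \<in> bracket_pairs A k"
  shows "subbundle_of_pair P \<in> isotropic_involutive_subbundles A k"
proof -
  obtain D l where P: "P = (D, l)" by (cases P)
  define L where "L = subbundle_of_pair P"
  have Lx: "L x = (\<lambda>\<alpha>. (l x \<alpha>, \<alpha>)) ` D x" for x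
    by (auto simp: L_def P subbundle_of_pair_def)
  have D: "subbundle (diff_forms A k) D" and bm: "l \<in> bundle_maps_to_tangent A k D"
    and ann: "\<And>x. annihilator A D x = {0}" and skew: "skew D l"
    and closed: "\<And>\<alpha> \<beta>. \<alpha> \<in> sections_of (diff_forms A k) D UNIV \<Longrightarrow> \<beta> \<in> sections_of (diff_forms A k) D UNIV \<Longrightarrow>
        form_bracket A l \<alpha> \<beta> \<in> sections_of (diff_forms A k) D UNIV"
    and hom: "\<And>\<alpha> \<beta> x. \<alpha> \<in> sections_of (diff_forms A k) D UNIV \<Longrightarrow> \<beta> \<in> sections_of (diff_forms A k) D UNIV \<Longrightarrow>
        l x (form_bracket A l \<alpha> \<beta> x) = lie_bracket A (\<lambda>y. l y (\<alpha> y)) (\<lambda>y. l y (\<beta> y)) x"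
    using assms unfolding P bracket_pairs_def by blast+
  have smooth: "\<And>W \<alpha>. open W \<Longrightarrow> \<alpha> \<in> sections_of (diff_forms A k) D W \<Longrightarrow> (\<lambda>x. l x (\<alpha> x)) \<in> vector_fields A W"
    and lin: "\<And>x \<alpha> \<beta> r. \<alpha> \<in> D x \<Longrightarrow> \<beta> \<in> D x \<Longrightarrow> l x (r *\<^sub>R \<alpha> + \<beta>) = r *\<^sub>R l x \<alpha> + l x \<beta>"
    using bm unfolding bundle_maps_to_tangent_def by blast+
  have "subbundle (gen_fields A k) (\<lambda>x. (\<lambda>\<alpha>. (l x \<alpha>, \<alpha>)) ` D x)"
    using D
  proof (rule subbundle_image)
    show "(\<lambda>x. (l x (E x), E x)) \<in> gen_fields A k W"
      if "open W" "E \<in> sections_of (diff_forms A k) D W" for W E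
      using smooth[OF that] that(2) by (simp add: gen_fields_def sections_of_def)
  qed (auto simp: lin inj_on_def)
  then have sub: "subbundle (gen_fields A k) L" unfolding Lx[symmetric] .
  have "isotropic A k L"
    unfolding isotropic_def
  proof (intro allI subsetI)
    fix x u assume "u \<in> L x"
    moreover have "pairing u v = 0" if "v \<in> L x" for v
      using that \<open>u \<in> L x\<close> skew by (auto simp: Lx pairing_def skew_def eq_neg_iff_add_eq_0)
    ultimately show "u \<in> orthogonal_fibre A k L x"
      using gen_subbundle_fibre[OF sub, of x] by (auto simp: orthogonal_fibre_def)
  qed
  moreover have "involutive A k L"
    unfolding involutive_def
  proof (intro ballI)
    fix s t assume st: "s \<in> sections_of (gen_fields A k) L UNIV" "t \<in> sections_of (gen_fields A k) L UNIV"
    \<comment> \<open>A section of the graph is the lift of its form part, so brackets of sections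
      of \<open>L\<close> reduce to brackets of sections of \<open>D\<close>.\<close>
    define \<alpha> \<beta> where "\<alpha> = (\<lambda>x. snd (s x))" and "\<beta> = (\<lambda>x. snd (t x))"
    have "snd u \<in> D x" if "u \<in> L x" for u x using that by (auto simp: Lx)
    with st have sec: "\<alpha> \<in> sections_of (diff_forms A k) D UNIV" "\<beta> \<in> sections_of (diff_forms A k) D UNIV"
      by (simp_all add: sections_of_def gen_fields_def \<alpha>_def \<beta>_def)
    have fst_eq: "fst (s x) = l x (\<alpha> x)" "fst (t x) = l x (\<beta> x)" for x
    proof -
      have "s x \<in> L x" "t x \<in> L x" using st by (auto simp: sections_of_def)
      then show "fst (s x) = l x (\<alpha> x)" "fst (t x) = l x (\<beta> x)" by (auto simp: \<alpha>_def \<beta>_def Lx)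
    qed
    \<comment> \<open>Preservation of brackets by \<open>l\<close> puts the Courant bracket in the
      graph; its vector part is then smooth because \<open>l\<close> is a bundle map.\<close>
    have "courant_bracket A s t = (\<lambda>x. (l x (form_bracket A l \<alpha> \<beta> x), form_bracket A l \<alpha> \<beta> x))"
      unfolding hom[OF sec]
      by (simp add: courant_bracket_def form_bracket_def Let_def fst_eq \<alpha>_def \<beta>_def)
    then show "courant_bracket A s t \<in> sections_of (gen_fields A k) L UNIV"
      using closed[OF sec] smooth[OF open_UNIV closed[OF sec]]
      by (auto simp: sections_of_def gen_fields_def Lx)
  qed
  moreover have "orthogonal_fibre A k L x \<inter> (tangent_space A x \<times> {0}) = {0}" for x
  proof -
    have "X = 0" if "(X, 0) \<in> orthogonal_fibre A k L x" for X
    proof -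
      have "X \<in> annihilator A D x"
        using that by (auto simp: orthogonal_fibre_def annihilator_def pairing_def Lx)
      then show ?thesis using ann[of x] by simp
    qed
    moreover have "0 \<in> tangent_space A x" "(0 :: ('m, 'e) tvec form) \<in> cotangent_power A k x"
      using subspace_0 subspace_tangent_space subspace_alt_forms by blast+
    \<comment> \<open>Read off from 0 lying in the annihilator.\<close>
    moreover have "interior_prod 0 \<alpha> = 0" if "\<alpha> \<in> D x" for \<alpha>
      using ann[of x] that by (auto simp: annihilator_def)
    ultimately show ?thesis
      by (auto simp: orthogonal_fibre_def pairing_def Lx zero_prod_def)
  qed
  ultimately show ?thesis
    using sub unfolding isotropic_involutive_subbundles_def L_def by blast
qed

section \<open>The two expressions for the bracket\<close>

text \<open>By skewness the exact term is \<open>- d (i_{\<lambda>\<beta>} \<alpha>)\<close>; it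
  cancels the exact term of the Cartan formula for \<open>\<lambda>\<beta>\<close> and
  \<open>\<alpha>\<close>, leaving the contraction of \<open>d \<alpha>\<close>.\<close>

lemma form_bracket_eq:
  assumes l: "l \<in> bundle_maps_to_tangent A k D" and skew: "skew D l"
    and \<alpha>: "\<alpha> \<in> sections_of (diff_forms A k) D UNIV" and \<beta>: "\<beta> \<in> sections_of (diff_forms A k) D UNIV"
  shows "form_bracket A l \<alpha> \<beta> x = lie_deriv A (\<lambda>y. l y (\<alpha> y)) \<beta> x - lie_deriv A (\<lambda>y. l y (\<beta> y)) \<alpha> x
    - ext_deriv A (\<lambda>y. interior_prod (l y (\<alpha> y)) (\<beta> y)) x"
proof -
  have Y: "(\<lambda>y. l y (\<beta> y)) \<in> vector_fields A UNIV"
    using l \<beta> unfolding bundle_maps_to_tangent_def by blast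
  have \<alpha>': "\<alpha> \<in> diff_forms A k UNIV" using \<alpha> by (simp add: sections_of_def)
  have eq: "(\<lambda>y. interior_prod (l y (\<alpha> y)) (\<beta> y)) = (\<lambda>y. - interior_prod (l y (\<beta> y)) (\<alpha> y))"
    using skew \<alpha> \<beta> unfolding skew_def sections_of_def by blast
  show ?thesis
    unfolding form_bracket_def eq cartan_formula[OF \<alpha>' Y] ext_deriv_uminus_interior_prod[OF \<alpha>' Y]
    by simp
qed

end

text \<open>The conjunct on \<open>inj_on snd\<close> makes the \<open>inv_into\<close> in
  \<open>pair_of_subbundle\<close> a genuine inverse of the projection of \<open>L\<close>. The last
  conjunct is the equality of the two bracket expressions in (c).\<close>

theorem proposition5p2:
  fixes A :: "('m::{t2_space, second_countable_topology}, 'e::real_normed_vector) chart set"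
    and k :: nat
  assumes "smooth_manifold A" and "k \<ge> 1"
  shows "bij_betw pair_of_subbundle (isotropic_involutive_subbundles A k) (bracket_pairs A k) \<and>
    bij_betw subbundle_of_pair (bracket_pairs A k) (isotropic_involutive_subbundles A k) \<and>
    (\<forall>L\<in>isotropic_involutive_subbundles A k.
       (\<forall>x. inj_on snd (L x)) \<and> subbundle_of_pair (pair_of_subbundle L) = L) \<and>
    (\<forall>P\<in>bracket_pairs A k. pair_of_subbundle (subbundle_of_pair P) = P) \<and>
    (\<forall>D l \<alpha> \<beta>. subbundle (diff_forms A k) D \<and> l \<in> bundle_maps_to_tangent A k D \<and> skew D l \<and>
       \<alpha> \<in> sections_of (diff_forms A k) D UNIV \<and> \<beta> \<in> sections_of (diff_forms A k) D UNIV \<longrightarrow>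
       (\<forall>x. form_bracket A l \<alpha> \<beta> x =
          lie_deriv A (\<lambda>y. l y (\<alpha> y)) \<beta> x - lie_deriv A (\<lambda>y. l y (\<beta> y)) \<alpha> x
          - ext_deriv A (\<lambda>y. interior_prod (l y (\<alpha> y)) (\<beta> y)) x))"
proof (intro conjI allI ballI impI)
  interpret atlas A by unfold_locales (rule assms(1))
  let ?I = "isotropic_involutive_subbundles A k" and ?B = "bracket_pairs A k"
  show inv: "subbundle_of_pair (pair_of_subbundle L) = L" if "L \<in> ?I" for L
    by (rule subbundle_of_pair_of_subbundle[OF inj_on_snd_of_isotropic[OF that]])
  show inv': "pair_of_subbundle (subbundle_of_pair P) = P" if "P \<in> ?B" for P
    by (rule pair_of_subbundle_of_pair[OF that])
  have maps: "pair_of_subbundle ` ?I \<subseteq> ?B" "subbundle_of_pair ` ?B \<subseteq> ?I"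
    using pair_of_subbundle_in_bracket_pairs subbundle_of_pair_in_isotropic_involutive by blast+
  show "bij_betw pair_of_subbundle ?I ?B"
    by (rule bij_betw_byWitness[OF _ _ maps]) (simp_all add: inv inv')
  show "bij_betw subbundle_of_pair ?B ?I"
    by (rule bij_betw_byWitness[OF _ _ maps(2,1)]) (simp_all add: inv inv')
  show "inj_on snd (L x)" if "L \<in> ?I" for L x
    by (rule inj_on_snd_of_isotropic[OF that])
qed (use atlas.form_bracket_eq[OF atlas.intro[OF assms(1)]] in blast)

end
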